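(* Let $\Psi$ be a Følner sequence on $\mathbb{N}$ and let $f\colon\mathbb{N}\to\mathbb{R}$ be a bounded function belonging to $\mathsf{Bes}(\mathbb{N},\Psi)^\perp$. Then for every non-empty Bohr set $B\subset\mathbb{N}$ and every bounded function $h\colon\mathbb{N}\to\mathbb{R}$ the set $$\Big\{\mathfrak{p}\in\mathsf{cl}(B): \limsup_{N\to\infty}\frac{1}{|\Psi_N|}\sum_{m\in\Psi_N}h(m)\,(\mathsf{R}^{\mathfrak{p}}f)(m)\ge0\Big\}$$ is Borel measurable and has positive measure with respect to every $\mu\in\mathcal{M}(\Psi)$.
   Context: A Følner sequence in $\mathbb{N}$ is a sequence $\Psi\colon N\mapsto\Psi_N$ of finite non-empty subsets of $\mathbb{N}$ with $|(\Psi_N+m)\triangle\Psi_N|/|\Psi_N|\to0$ for all $m\in\mathbb{N}$. $\mathsf{Bes}(\mathbb{N},\Psi)^\perp$ is the set of $f$ with $\big(\limsup_N\frac{1}{|\Psi_N|}\sum_{n\in\Psi_N}|f(n)|^2\big)^{1/2}<\infty$ and $\lim_{N}\frac{1}{|\Psi_N|}\sum_{n\in\Psi_N}f(n)e^{2\pi in\theta}=0$ for all $\theta\in[0,1)$. $\beta\mathbb{N}$ is the space of ultrafilters on $\mathbb{N}$ with the topology generated by the sets $\mathsf{cl}(A)=\{\mathfrak{p}:A\in\mathfrak{p}\}$, $A\subset\mathbb{N}$, with $n$ identified with the principal ultrafilter at $n$. For an ultrafilter $\mathfrak{p}$ and bounded $f$, $(\mathsf{R}^{\mathfrak{p}}f)(n)=\lim_{m\to\mathfrak{p}}f(n+m)$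 (ultrafilter limit). $\mathcal{M}(\Psi)$ is the set of Radon probability measures on $\beta\mathbb{N}$ that are weak$^*$ accumulation points of $\{\frac{1}{|\Psi_N|}\sum_{n\in\Psi_N}\delta_n:N\in\mathbb{N}\}$. A Bohr set is a set $a^{-1}(U)$ with $a$ a homomorphism from $(\mathbb{N},+)$ into a compact metrizable abelian group $K$ and $U\subset K$ a non-empty open set whose boundary has zero Haar measure. *)

theory Defs
  imports "HOL-Analysis.Analysis" "HOL-Probability.Probability"
begin

definition foelner :: "(nat \<Rightarrow> nat set) \<Rightarrow> bool" where
  "foelner \<Psi> \<longleftrightarrow>
     (\<forall>N. finite (\<Psi> N) \<and> \<Psi> N \<noteq> {}) \<and>
     (\<forall>m. (\<lambda>N. real (card ((((+) m) ` \<Psi> N - \<Psi> N) \<union> (\<Psi> N - ((+) m) ` \<Psi> N)))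
                   / real (card (\<Psi> N))) \<longlonglongrightarrow> 0)"

definition avg :: "(nat \<Rightarrow> nat set) \<Rightarrow> nat \<Rightarrow> (nat \<Rightarrow> 'a::real_normed_field) \<Rightarrow> 'a" where
  "avg \<Psi> N g = (\<Sum>n\<in>\<Psi> N. g n) / of_nat (card (\<Psi> N))"

definition Bes_perp :: "(nat \<Rightarrow> nat set) \<Rightarrow> (nat \<Rightarrow> real) set" where
  "Bes_perp \<Psi> = {f.
     limsup (\<lambda>N. ereal (avg \<Psi> N (\<lambda>n. (f n)\<^sup>2))) < \<infinity> \<and>
     (\<forall>\<theta>::real. 0 \<le> \<theta> \<and> \<theta> < 1 \<longrightarrow>
        (\<lambda>N. avg \<Psi> N (\<lambda>n. complex_of_real (f n) * exp (2 * pi * \<i> * of_nat n * of_real \<theta>)))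
          \<longlonglongrightarrow> 0)}"

definition ultrafilter :: "'a filter \<Rightarrow> bool" where
  "ultrafilter F \<longleftrightarrow> F \<noteq> bot \<and> (\<forall>P. eventually P F \<or> eventually (\<lambda>x. \<not> P x) F)"

definition clb :: "nat set \<Rightarrow> nat filter set" where
  "clb A = {p. ultrafilter p \<and> eventually (\<lambda>n. n \<in> A) p}"

definition betaN :: "nat filter topology" where
  "betaN = topology_generated_by (range clb)"

definition pu :: "nat \<Rightarrow> nat filter" where
  "pu n = principal {n}"

definition Rsh :: "nat filter \<Rightarrow> (nat \<Rightarrow> real) \<Rightarrow> nat \<Rightarrow> real" where
  "Rsh p f n = Lim p (\<lambda>m. f (n + m))"

definition borel_of :: "'a topology \<Rightarrow> 'a measure" where
  "borel_of X = sigma (topspace X) {U. openin X U}"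

definition radon_prob :: "'a topology \<Rightarrow> 'a measure \<Rightarrow> bool" where
  "radon_prob X \<mu> \<longleftrightarrow>
     sets \<mu> = sets (borel_of X) \<and> prob_space \<mu> \<and>
     (\<forall>A\<in>sets \<mu>. emeasure \<mu> A = (SUP K\<in>{K. compactin X K \<and> K \<subseteq> A}. emeasure \<mu> K))"

text \<open>\<open>\<M>(\<Psi>)\<close>: Radon probability measures on \<open>\<beta>\<nat>\<close> that are weak* accumulation points of
  the averages of Dirac measures \<open>\<delta>_n\<close>, \<open>n \<in> \<Psi>_N\<close>. A basic weak* neighbourhood of \<open>\<mu>\<close> is
  given by finitely many continuous real functions \<open>g_1,\<dots>,g_k\<close> on \<open>\<beta>\<nat>\<close> and \<open>\<epsilon> > 0\<close>.\<close>
definition Mset :: "(nat \<Rightarrow> nat set) \<Rightarrow> nat filter measure set" where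
  "Mset \<Psi> = {\<mu>. radon_prob betaN \<mu> \<and>
     (\<forall>G::(nat filter \<Rightarrow> real) set. \<forall>\<epsilon>>0. \<forall>N0.
        finite G \<and> (\<forall>g\<in>G. continuous_map betaN euclideanreal g) \<longrightarrow>
        (\<exists>N\<ge>N0. \<forall>g\<in>G. \<bar>(\<integral>x. g x \<partial>\<mu>) - avg \<Psi> N (\<lambda>n. g (pu n))\<bar> < \<epsilon>))}"

definition haar_measure :: "'k::{metric_space, ab_group_add, topological_group_add} measure \<Rightarrow> bool" where
  "haar_measure H \<longleftrightarrow> sets H = sets borel \<and> prob_space H \<and>
     (\<forall>x. \<forall>A\<in>sets borel. emeasure H ((+) x ` A) = emeasure H A)"

text \<open>\<open>bohr_data a U\<close>: \<open>a\<close> is a homomorphism from \<open>(\<nat>,+)\<close> into the compact metrizable abelian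
  group \<open>'k\<close>, and \<open>U\<close> is a non-empty open set whose boundary is Haar-null. The Bohr set is \<open>a -` U\<close>.\<close>
definition bohr_data :: "(nat \<Rightarrow> 'k::{metric_space, ab_group_add, topological_group_add}) \<Rightarrow> 'k set \<Rightarrow> bool" where
  "bohr_data a U \<longleftrightarrow>
        compact (UNIV :: 'k set) \<and>
        (\<forall>m n. a (m + n) = a m + a n) \<and>
        open U \<and> U \<noteq> {} \<and>
        (\<exists>H. haar_measure H \<and> emeasure H (frontier U) = 0)"

end

theory Submission
  imports Defs
begin

text \<open>
  Let \<open>\<mu> \<in> \<M>(\<Psi>)\<close>. Integrating the continuous extension of a bounded sequence to \<open>\<beta>\<nat>\<close> against
  \<open>\<mu>\<close> gives a shift-invariant mean \<open>\<Lambda>\<close> on bounded sequences that agrees with the limit of the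
  averages along \<open>\<Psi>\<close> whenever it exists, so \<open>\<Lambda>\<close> annihilates \<open>f(n) e\<^sup>i\<^sup>n\<^sup>\<theta>\<close> for all \<open>\<theta>\<close>.

  Instead of the indicator function of \<open>B\<close> we use an almost periodic sequence \<open>b = g \<circ> a \<ge> 0\<close>, where
  \<open>g\<close> is a continuous bump supported in \<open>U\<close> around a point of the orbit; then \<open>\<Lambda>(b) > 0\<close> by
  recurrence. The point is that \<open>\<Lambda>(T\<^sup>m f \<cdot> b) = 0\<close>. Put \<open>G(k) = \<Lambda>(f \<cdot> T\<^sup>k b)\<close>, again almost periodic. Its
  exponential averages over windows of length \<open>N\<close> tend to \<open>0\<close>, uniformly in \<open>\<theta>\<close> by compactness, so by
  Parseval the correlations \<open>N\<^sup>-\<^sup>1 \<Sum> cnj (G i) G(i + k)\<close> are small in mean square over \<open>k < N\<close>. For the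
  syndetic set of almost periods \<open>k\<close> they are close to the mean of \<open>|G|\<^sup>2\<close>, which must vanish, so \<open>G = 0\<close>.
  This replaces Peter--Weyl theory for the group generated by \<open>a\<close>.

  Hence every \<open>\<phi>\<^sub>N(p) = |\<Psi>\<^sub>N|\<^sup>-\<^sup>1 \<Sum> h(m) (R\<^sup>p f)(m)\<close> has integral \<open>0\<close> against the extension \<open>w\<close> of \<open>b\<close>,
  which lives on \<open>cl(B)\<close>, and by Fatou's lemma \<open>limsup \<phi>\<^sub>N < 0\<close> cannot hold almost everywhere on
  \<open>{w > 0}\<close>.
\<close>

section \<open>Almost periodic sequences with null spectrum\<close>

text \<open>Bohr's almost periodicity: for every tolerance the uniform almost periods are relatively
  dense, with \<open>Q\<close> bounding the gaps between them.\<close>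

definition syndetic_periods :: "(nat \<Rightarrow> 'a::real_normed_vector) \<Rightarrow> bool" where
  "syndetic_periods G \<longleftrightarrow>
     (\<forall>e>0. \<exists>Q>0. \<forall>m. \<exists>k\<in>{m..<m + Q}. \<forall>n. norm (G (n + k) - G n) \<le> e)"

section \<open>Discrete Fourier analysis on roots of unity\<close>

lemma sum_unity_root:
  fixes P :: nat and d :: int
  assumes "P > 0" "\<bar>d\<bar> < int P"
  shows "(\<Sum>t<P. cis (2 * pi * real t * real_of_int d / real P)) = (if d = 0 then of_nat P else 0)"
proof (cases "d = 0")
  case False
  define z where "z = cis (2 * pi * real_of_int d / real P)"
  have pow: "cis (2 * pi * real t * real_of_int d / real P) = z ^ t" for t
    by (simp add: z_def Complex.DeMoivre mult_ac)
  have zP: "z ^ P = 1"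
    using assms by (simp add: z_def Complex.DeMoivre)
  \<comment> \<open>The bound \<open>\<bar>d\<bar> < int P\<close> keeps \<open>P\<close> from
    dividing a non-zero \<open>d\<close>, so \<open>z\<close> is a nontrivial root of unity and its
    geometric sum vanishes.\<close>
  have "z \<noteq> 1"
  proof
    assume "z = 1"
    then have "cos (2 * pi * real_of_int d / real P) = 1"
      by (simp add: z_def complex_eq_iff)
    then obtain x :: int where "2 * pi * real_of_int d / real P = of_int x * 2 * pi"
      by (auto simp: cos_one_2pi_int)
    then have "real_of_int d = real_of_int x * real P"
      using assms by (simp add: field_simps)
    then have "d = x * int P"
      by (metis of_int_eq_iff of_int_mult of_int_of_nat_eq)
    with assms False show False
      by (auto simp: abs_mult)
  qed
  then have "(\<Sum>t<P. z ^ t) = 0"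
    by (simp add: sum_gp_strict zP)
  then show ?thesis using False by (simp add: pow)
qed simp

text \<open>Discrete Parseval identity. All exponents lie below \<open>P\<close>, so no two of them
  agree modulo \<open>P\<close> and the cross terms drop out by
  \<open>sum_unity_root\<close>.\<close>

lemma parseval_poly:
  fixes p :: "complex poly"
  assumes "degree p < P"
  shows "(\<Sum>t<P. (norm (poly p (cis (2 * pi * real t / real P))))\<^sup>2)
           = real P * (\<Sum>i<P. (norm (coeff p i))\<^sup>2)"
proof -
  have ev: "poly p z = (\<Sum>i<P. coeff p i * z ^ i)" for z
    unfolding poly_altdef
    by (rule sum.mono_neutral_left) (use assms in \<open>auto simp: coeff_eq_0\<close>)
  have P: "P > 0" using assms by simp
  define w where "w t = cis (2 * pi * real t / real P)" for t
  have ww: "w t ^ i * cnj (w t ^ j) = cis (2 * pi * real t * real_of_int (int i - int j) / real P)" for t i j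
    by (simp add: w_def Complex.DeMoivre cis_cnj cis_mult algebra_simps diff_divide_distrib)
  have "complex_of_real (\<Sum>t<P. (norm (poly p (w t)))\<^sup>2)
      = (\<Sum>t<P. poly p (w t) * cnj (poly p (w t)))"
    by (simp add: complex_norm_square del: of_real_power)
  also have "\<dots> = (\<Sum>t<P. \<Sum>i<P. \<Sum>j<P. coeff p i * cnj (coeff p j) * (w t ^ i * cnj (w t ^ j)))"
    by (simp add: ev sum_product mult_ac)
  also have "\<dots> = (\<Sum>i<P. \<Sum>j<P. \<Sum>t<P. coeff p i * cnj (coeff p j) * (w t ^ i * cnj (w t ^ j)))"
    by (subst sum.swap, rule sum.cong, simp, subst sum.swap, simp)
  also have "\<dots> = (\<Sum>i<P. \<Sum>j<P. coeff p i * cnj (coeff p j) * (if i = j then of_nat P else 0))"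
  proof (intro sum.cong refl)
    fix i j assume "i \<in> {..<P}" "j \<in> {..<P}"
    then have "(\<Sum>t<P. cis (2 * pi * real t * real_of_int (int i - int j) / real P))
        = (if i = j then of_nat P else 0)"
      by (subst sum_unity_root[OF P]) auto
    then show "(\<Sum>t<P. coeff p i * cnj (coeff p j) * (w t ^ i * cnj (w t ^ j)))
        = coeff p i * cnj (coeff p j) * (if i = j then of_nat P else 0)"
      unfolding ww by (simp only: flip: sum_distrib_left)
  qed
  also have "\<dots> = (\<Sum>i<P. coeff p i * cnj (coeff p i) * of_nat P)"
    by (intro sum.cong refl) (simp add: if_distrib[of "\<lambda>x. _ * x"] cong: if_cong)
  also have "\<dots> = complex_of_real (real P * (\<Sum>i<P. (norm (coeff p i))\<^sup>2))"
    by (simp add: complex_norm_square sum_distrib_left mult_ac del: of_real_power)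
  finally show ?thesis unfolding w_def of_real_eq_iff .
qed

text \<open>The reversed conjugate of the first \<open>N\<close> terms of \<open>G\<close>, multiplied with the first \<open>2N\<close> terms
  as polynomials, has the correlations of \<open>G\<close> among its coefficients; the modulus of the first
  factor on the unit circle is bounded by hypothesis.\<close>
lemma correlations_square_bound:
  fixes G :: "nat \<Rightarrow> complex"
  assumes M: "\<And>n. norm (G n) \<le> M"
    and E: "\<And>\<theta>. norm (\<Sum>i<N. cis (real i * \<theta>) * G i) \<le> E"
    and N: "N > 0"
  shows "(\<Sum>k<N. (norm (\<Sum>i<N. cnj (G i) * G (i + k)))\<^sup>2) \<le> E\<^sup>2 * (2 * real N * M\<^sup>2)"
proof -
  define X where "X = (\<Sum>i<N. monom (cnj (G (N - 1 - i))) i)"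
  define Y where "Y = (\<Sum>j<2 * N. monom (G j) j)"
  \<comment> \<open>The product \<open>X * Y\<close> has degree at most \<open>3 * N - 2\<close>, so
    this many sample points avoid aliasing.\<close>
  define P where "P = 3 * N"
  define w where "w t = cis (2 * pi * real t / real P)" for t
  have cX: "coeff X i = (if i < N then cnj (G (N - 1 - i)) else 0)" for i
    by (simp add: X_def coeff_sum)
  have cY: "coeff Y i = (if i < 2 * N then G i else 0)" for i
    by (simp add: Y_def coeff_sum)
  have dX: "degree X \<le> N - 1" by (rule degree_le) (auto simp: cX)
  have dY: "degree Y \<le> 2 * N - 1" by (rule degree_le) (auto simp: cY)
  have d: "degree (X * Y) < P" "degree Y < P"
    using dX dY N degree_mult_le[of X Y] by (auto simp: P_def)
  \<comment> \<open>On the unit circle inversion is conjugation, so reversing and conjugating the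
    coefficients changes the exponential sum of \<open>G\<close> only by conjugation and the
    unimodular factor \<open>w t ^ (N - 1)\<close>.\<close>
  have X_le: "norm (poly X (w t)) \<le> E" for t
  proof -
    define \<theta> where "\<theta> = 2 * pi * real t / real P"
    have "poly X (w t) = (\<Sum>i<N. cnj (G (N - 1 - i)) * w t ^ i)"
      by (simp add: X_def poly_sum poly_monom)
    also have "\<dots> = (\<Sum>i<N. cnj (G i) * w t ^ (N - 1 - i))"
      by (subst sum.nat_diff_reindex[symmetric]) (intro sum.cong refl, auto)
    also have "\<dots> = (\<Sum>i<N. w t ^ (N - 1) * cnj (cis (real i * \<theta>) * G i))"
    proof (intro sum.cong refl)
      fix i assume "i \<in> {..<N}"
      then have i: "N - 1 = (N - 1 - i) + i" by auto
      have "w t ^ i * cnj (cis (real i * \<theta>)) = 1"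
        by (simp add: w_def \<theta>_def Complex.DeMoivre cis_cnj cis_mult)
      then have "w t ^ (N - 1) * cnj (cis (real i * \<theta>)) = w t ^ (N - 1 - i)"
        by (subst i, subst power_add) (simp add: mult.assoc)
      then show "cnj (G i) * w t ^ (N - 1 - i) = w t ^ (N - 1) * cnj (cis (real i * \<theta>) * G i)"
        by (metis complex_cnj_mult mult.assoc mult.commute)
    qed
    also have "\<dots> = w t ^ (N - 1) * cnj (\<Sum>i<N. cis (real i * \<theta>) * G i)"
      by (simp add: sum_distrib_left)
    finally have "norm (poly X (w t)) = norm (\<Sum>i<N. cis (real i * \<theta>) * G i)"
      by (simp only: norm_mult norm_power w_def norm_cis power_one mult_1 complex_mod_cnj)
    then show ?thesis using E by simp
  qed
  \<comment> \<open>For \<open>k < N\<close> the coefficients of \<open>Y\<close> that are met have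
    index below \<open>2 * N\<close>, so the truncation loses no term of the correlation.\<close>
  have co: "coeff (X * Y) (N - 1 + k) = (\<Sum>i<N. cnj (G i) * G (i + k))" if "k < N" for k
  proof -
    have "coeff (X * Y) (N - 1 + k) = (\<Sum>i\<le>N - 1 + k. coeff X i * coeff Y (N - 1 + k - i))"
      by (simp add: coeff_mult)
    also have "\<dots> = (\<Sum>i<N. coeff X i * coeff Y (N - 1 + k - i))"
      by (rule sum.mono_neutral_right) (use N in \<open>auto simp: cX\<close>)
    also have "\<dots> = (\<Sum>i<N. cnj (G (N - 1 - i)) * G ((N - 1 - i) + k))"
      by (intro sum.cong refl) (use that in \<open>auto simp: cX cY\<close>)
    also have "\<dots> = (\<Sum>i<N. cnj (G i) * G (i + k))"
      by (subst sum.nat_diff_reindex[symmetric]) (intro sum.cong refl, auto)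
    finally show ?thesis .
  qed
  have "real P * (\<Sum>k<N. (norm (\<Sum>i<N. cnj (G i) * G (i + k)))\<^sup>2)
      = real P * (\<Sum>k<N. (norm (coeff (X * Y) (N - 1 + k)))\<^sup>2)"
    by (intro arg_cong2[of _ _ _ _ "(*)"] sum.cong refl) (simp only: co lessThan_iff)
  also have "\<dots> = real P * (\<Sum>i\<in>(+) (N - 1) ` {..<N}. (norm (coeff (X * Y) i))\<^sup>2)"
    by (subst sum.reindex) auto
  also have "\<dots> \<le> real P * (\<Sum>i<P. (norm (coeff (X * Y) i))\<^sup>2)"
    by (intro mult_left_mono sum_mono2) (auto simp: P_def)
  also have "\<dots> = (\<Sum>t<P. (norm (poly (X * Y) (w t)))\<^sup>2)"
    unfolding w_def by (rule parseval_poly[symmetric]) (rule d)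
  also have "\<dots> \<le> (\<Sum>t<P. E\<^sup>2 * (norm (poly Y (w t)))\<^sup>2)"
    by (intro sum_mono) (auto simp: norm_mult power_mult_distrib intro!: mult_right_mono power_mono X_le)
  also have "\<dots> = E\<^sup>2 * (real P * (\<Sum>i<P. (norm (coeff Y i))\<^sup>2))"
    unfolding w_def by (subst parseval_poly[symmetric]) (rule d, simp add: sum_distrib_left)
  also have "(\<Sum>i<P. (norm (coeff Y i))\<^sup>2) = (\<Sum>i<2 * N. (norm (G i))\<^sup>2)"
    by (rule sum.mono_neutral_cong_right) (auto simp: P_def cY)
  also have "E\<^sup>2 * (real P * (\<Sum>i<2 * N. (norm (G i))\<^sup>2)) \<le> E\<^sup>2 * (real P * (\<Sum>i<2 * N. M\<^sup>2))"
    by (intro mult_left_mono sum_mono power_mono M) auto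
  also have "\<dots> = real P * (E\<^sup>2 * (2 * real N * M\<^sup>2))" by simp
  finally show ?thesis
    using N by (simp add: P_def mult_ac)
qed

text \<open>Turns recurrence with gap \<open>Q\<close> into a density: the range splits into
  \<open>T\<close> consecutive windows, each with a term of size at least \<open>c\<close>.\<close>

lemma sum_blocks_ge:
  fixes g :: "nat \<Rightarrow> real"
  assumes "\<And>n. g n \<ge> 0" and "\<And>m. \<exists>k\<in>{m..<m + Q}. g k \<ge> c"
  shows "(\<Sum>k<T * Q. g k) \<ge> real T * c"
proof (induction T)
  case (Suc T)
  obtain k where k: "k \<in> {T * Q..<T * Q + Q}" "g k \<ge> c" using assms(2) by blast
  have "g k \<le> (\<Sum>i\<in>{T * Q..<T * Q + Q}. g i)"
    by (rule member_le_sum) (use k assms in auto)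
  moreover have "(\<Sum>k<Suc T * Q. g k) = (\<Sum>k<T * Q. g k) + (\<Sum>i\<in>{T * Q..<T * Q + Q}. g i)"
    by (simp add: lessThan_atLeast0 sum.atLeastLessThan_concat add.commute)
  ultimately show ?case using Suc k by (simp add: algebra_simps)
qed simp

text \<open>If \<open>G 0\<close> were non-zero, almost periodicity would make the squared
  correlations over \<open>k < N\<close> total at least a fixed multiple of \<open>N^3\<close>,
  while \<open>F\<close> makes them a smaller multiple. The bound in \<open>F\<close> covers all
  multiples of one length, which leaves room to make the length divisible by the recurrence gaps as
  well.\<close>

lemma vanishing_of_null_spectrum:
  fixes G :: "nat \<Rightarrow> complex"
  assumes M: "\<And>n. norm (G n) \<le> M"
    and ap: "syndetic_periods G"
    and F: "\<And>e. e > 0 \<Longrightarrow> \<exists>N>0. \<forall>T \<theta>. norm (\<Sum>i<T * N. cis (real i * \<theta>) * G i) \<le> e * real (T * N)"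
  shows "G 0 = 0"
proof (rule ccontr)
  assume "G 0 \<noteq> 0"
  define \<eta> where "\<eta> = norm (G 0)"
  have \<eta>: "\<eta> > 0" using \<open>G 0 \<noteq> 0\<close> by (simp add: \<eta>_def)
  have Mp: "M > 0" using M[of 0] \<eta> unfolding \<eta>_def by linarith
  obtain Q where Q: "Q > 0" "\<And>m. \<exists>k\<in>{m..<m + Q}. \<forall>n. norm (G (n + k) - G n) \<le> \<eta> / 2"
    using ap \<eta> unfolding syndetic_periods_def by (meson half_gt_zero)
  \<comment> \<open>Every window of length \<open>Q\<close> has a term of norm at least
    \<open>\<eta> / 2\<close>, so \<open>\<kappa>\<close> bounds the average of \<open>|G|^2\<close>
    from below.\<close>
  define \<kappa> where "\<kappa> = (\<eta> / 2)\<^sup>2 / real Q"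
  have \<kappa>: "\<kappa> > 0" using Q \<eta> by (simp add: \<kappa>_def)
  \<comment> \<open>With this tolerance, removing the shift from a correlation costs at most
    \<open>M * (\<kappa> / (2 * M)) = \<kappa> / 2\<close> per term, half of the guaranteed
    average.\<close>
  have "\<kappa> / (2 * M) > 0" using \<kappa> Mp by simp
  then obtain Q' where Q': "Q' > 0" "\<And>m. \<exists>k\<in>{m..<m + Q'}. \<forall>n. norm (G (n + k) - G n) \<le> \<kappa> / (2 * M)"
    using ap unfolding syndetic_periods_def by blast
  \<comment> \<open>This makes the upper bound \<open>\<kappa>^2 N^3 / (8 Q'^2)\<close>, which lies
    below the lower bound \<open>\<kappa>^2 N^3 / (4 Q')\<close>.\<close>
  define e where "e = \<kappa> / (4 * M * real Q')"
  have e: "e > 0" using \<kappa> Mp Q' by (simp add: e_def)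
  obtain N0 where N0: "N0 > 0"
    "\<And>T \<theta>. norm (\<Sum>i<T * N0. cis (real i * \<theta>) * G i) \<le> e * real (T * N0)"
    using F[OF e] by blast
  \<comment> \<open>Divisible by \<open>Q\<close>, \<open>Q'\<close> and \<open>N0\<close>, so that
    both block decompositions are exact and \<open>N0(2)\<close> applies.\<close>
  define N where "N = Q * Q' * N0"
  have N: "N > 0" using Q Q' N0 by (simp add: N_def)
  have energy: "(\<Sum>i<N. (norm (G i))\<^sup>2) \<ge> real N * \<kappa>"
  proof -
    have "(\<Sum>i<(Q' * N0) * Q. (norm (G i))\<^sup>2) \<ge> real (Q' * N0) * (\<eta> / 2)\<^sup>2"
    proof (rule sum_blocks_ge)
      fix m
      obtain k where k: "k \<in> {m..<m + Q}" "\<forall>n. norm (G (n + k) - G n) \<le> \<eta> / 2" using Q by blast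
      have "norm (G 0) \<le> norm (G (0 + k)) + norm (G (0 + k) - G 0)"
        by (metis norm_minus_commute norm_triangle_sub)
      with k(2) have "norm (G k) \<ge> \<eta> / 2"
        unfolding \<eta>_def by (smt (verit) add_0 field_sum_of_halves)
      then have "(norm (G k))\<^sup>2 \<ge> (\<eta> / 2)\<^sup>2" using \<eta> by (intro power_mono) auto
      then show "\<exists>k\<in>{m..<m + Q}. (\<eta> / 2)\<^sup>2 \<le> (norm (G k))\<^sup>2" using k by blast
    qed simp
    moreover have "real (Q' * N0) * (\<eta> / 2)\<^sup>2 = real N * \<kappa>"
      using Q by (simp add: N_def \<kappa>_def)
    moreover have "(Q' * N0) * Q = N" by (simp add: N_def)
    ultimately show ?thesis by simp
  qed
  have "(\<Sum>k<(Q * N0) * Q'. (norm (\<Sum>i<N. cnj (G i) * G (i + k)))\<^sup>2)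
      \<ge> real (Q * N0) * (real N * \<kappa> / 2)\<^sup>2"
  proof (rule sum_blocks_ge)
    fix m
    obtain k where k: "k \<in> {m..<m + Q'}" "\<And>n. norm (G (n + k) - G n) \<le> \<kappa> / (2 * M)" using Q' by blast
    have "complex_of_real (\<Sum>i<N. (norm (G i))\<^sup>2) = (\<Sum>i<N. cnj (G i) * G i)"
      by (simp add: complex_norm_square mult.commute del: of_real_power)
    also have "\<dots> = (\<Sum>i<N. cnj (G i) * G (i + k)) - (\<Sum>i<N. cnj (G i) * (G (i + k) - G i))"
      by (simp add: algebra_simps sum_subtractf)
    finally have "norm (complex_of_real (\<Sum>i<N. (norm (G i))\<^sup>2))
        \<le> norm (\<Sum>i<N. cnj (G i) * G (i + k)) + norm (\<Sum>i<N. cnj (G i) * (G (i + k) - G i))"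
      by (metis norm_triangle_ineq4)
    moreover have "norm (complex_of_real (\<Sum>i<N. (norm (G i))\<^sup>2)) = (\<Sum>i<N. (norm (G i))\<^sup>2)"
      by (simp only: norm_of_real) (simp add: sum_nonneg)
    moreover have "norm (\<Sum>i<N. cnj (G i) * (G (i + k) - G i)) \<le> (\<Sum>i<N. M * (\<kappa> / (2 * M)))"
      by (rule sum_norm_le) (simp only: norm_mult complex_mod_cnj, intro mult_mono M k(2) norm_ge_zero less_imp_le[OF Mp])
    moreover have "(\<Sum>i<N. M * (\<kappa> / (2 * M))) = real N * \<kappa> / 2" using Mp by simp
    ultimately have "norm (\<Sum>i<N. cnj (G i) * G (i + k)) \<ge> real N * \<kappa> / 2"
      using energy by linarith
    then have "(norm (\<Sum>i<N. cnj (G i) * G (i + k)))\<^sup>2 \<ge> (real N * \<kappa> / 2)\<^sup>2"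
      using \<kappa> by (intro power_mono) auto
    then show "\<exists>k\<in>{m..<m + Q'}. (real N * \<kappa> / 2)\<^sup>2 \<le> (norm (\<Sum>i<N. cnj (G i) * G (i + k)))\<^sup>2"
      using k by blast
  qed simp
  moreover have "(Q * N0) * Q' = N" by (simp add: N_def)
  ultimately have lower: "(\<Sum>k<N. (norm (\<Sum>i<N. cnj (G i) * G (i + k)))\<^sup>2)
      \<ge> real (Q * N0) * (real N * \<kappa> / 2)\<^sup>2" by metis
  have upper: "(\<Sum>k<N. (norm (\<Sum>i<N. cnj (G i) * G (i + k)))\<^sup>2)
      \<le> (e * real N)\<^sup>2 * (2 * real N * M\<^sup>2)"
    by (rule correlations_square_bound[OF M _ N]) (unfold N_def, rule N0(2))
  have "(e * real N)\<^sup>2 * (2 * real N * M\<^sup>2) = (real N)\<^sup>2 * \<kappa>\<^sup>2 * real N / (8 * (real Q')\<^sup>2)"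
    using Mp Q' by (simp add: e_def power2_eq_square field_simps)
  also have "\<dots> = (real N)\<^sup>2 * \<kappa>\<^sup>2 * real (Q * N0) / (8 * real Q')"
    using Q' by (simp add: N_def power2_eq_square field_simps)
  also have "\<dots> \<le> (real N)\<^sup>2 * \<kappa>\<^sup>2 * real (Q * N0) / (8 * 1)"
    by (rule divide_left_mono) (use Q' in auto)
  also have "\<dots> < (real N)\<^sup>2 * \<kappa>\<^sup>2 * real (Q * N0) / 4"
    using N \<kappa> Q N0 by (simp add: field_simps)
  also have "\<dots> = real (Q * N0) * (real N * \<kappa> / 2)\<^sup>2"
    by (simp add: power2_eq_square)
  finally show False using upper lower by linarith
qed

section \<open>Invariant means and almost periodic sequences\<close>

lemma cis_mult_frac: "cis (real n * (2 * pi * frac x)) = cis (real n * (2 * pi * x))"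
proof -
  have "real n * (2 * pi * x) = real n * (2 * pi * frac x) + 2 * pi * real_of_int (int n * \<lfloor>x\<rfloor>)"
    by (simp add: frac_def algebra_simps)
  then show ?thesis by (simp only: cis_mult[symmetric]) simp
qed

lemma norm_cis_diff_le: "norm (cis x - cis y) \<le> \<bar>x - y\<bar>"
proof -
  have "norm (cis x - cis y) = norm (cis y * (cis (x - y) - 1))"
    by (simp add: right_diff_distrib cis_mult)
  also have "\<dots> = norm (exp (\<i> * of_real (x - y)) - 1)"
    by (simp add: norm_mult cis_conv_exp)
  also have "\<dots> \<le> \<bar>x - y\<bar>"
    using dist_exp_i_1[of "x - y"] abs_sin_x_le_abs_x[of "(x - y) / 2"]
    by (simp add: dist_norm)
  finally show ?thesis .
qed

text \<open>A maximal pairwise non-close set stays maximal after translation by \<open>m\<close>, so one of its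
  translated points must be close to \<open>0\<close>.\<close>
lemma syndetic_of_finite_colouring:
  fixes close :: "nat \<Rightarrow> nat \<Rightarrow> bool" and c :: "nat \<Rightarrow> 'c"
  assumes fin: "finite (range c)"
    and col: "\<And>j k. c j = c k \<Longrightarrow> close j k"
    and sym: "\<And>j k. close j k \<Longrightarrow> close k j"
    and tr: "\<And>j k m. close (j + m) (k + m) \<Longrightarrow> close j k"
  shows "\<exists>Q>0. \<forall>m. \<exists>k\<in>{m..<m + Q}. close k 0"
proof -
  define sep where "sep F \<longleftrightarrow> finite F \<and> (\<forall>j\<in>F. \<forall>k\<in>F. j \<noteq> k \<longrightarrow> \<not> close j k)" for F
  \<comment> \<open>Distinct points of a separated set have distinct colours, so a separated set of
    greatest size exists.\<close>
  have bound: "card F \<le> card (range c)" if "sep F" for F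
  proof -
    have "inj_on c F" using that col unfolding sep_def inj_on_def by blast
    then show ?thesis using fin by (metis card_image card_mono image_mono subset_UNIV)
  qed
  have "sep {}" by (simp add: sep_def)
  then have "\<exists>F. sep F \<and> (\<forall>F'. sep F' \<longrightarrow> card F' \<le> card F)"
    by (rule ex_has_greatest_nat[where b = "Suc (card (range c))"]) (use bound in \<open>auto simp: less_Suc_eq_le\<close>)
  then obtain F where F: "sep F" "\<And>F'. sep F' \<Longrightarrow> card F' \<le> card F" by blast
  have finF: "finite F" using F by (simp add: sep_def)
  obtain Q where Q: "\<And>k. k \<in> F \<Longrightarrow> k < Q" "Q > 0"
    using finite_nat_set_iff_bounded[of F] finF by (metis less_Suc_eq zero_less_Suc)
  have "\<exists>k\<in>{m..<m + Q}. close k 0" for m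
  proof (rule ccontr)
    assume no: "\<not> (\<exists>k\<in>{m..<m + Q}. close k 0)"
    define F' where "F' = (\<lambda>k. k + m) ` F"
    have nc: "\<not> close k 0" if "k \<in> F'" for k
      using no that Q unfolding F'_def by fastforce
    have sepF': "sep F'" using F(1) unfolding sep_def F'_def by (auto dest: tr)
    \<comment> \<open>By \<open>col\<close> the point \<open>0\<close> is close to itself, so it
      cannot satisfy \<open>nc\<close>; adjoining it to \<open>F'\<close> therefore raises the
      cardinality.\<close>
    have "0 \<notin> F'" using nc col by blast
    moreover have "card F' = card F" unfolding F'_def by (rule card_image) simp
    moreover have "sep (insert 0 F')" using sepF' nc sym unfolding sep_def by blast
    ultimately show False using F(2)[of "insert 0 F'"] sepF' by (simp add: sep_def)
  qed
  then show ?thesis using Q by blast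
qed

text \<open>The points \<open>(a n, cis (n \<theta>))\<close> lie in a compact space, and a finite
  cover by small balls colours them as \<open>syndetic_of_finite_colouring\<close> requires.
  Treating both coordinates at once yields a single \<open>k\<close> that serves
  \<open>g \<circ> a\<close> and the exponential.\<close>

lemma bohr_periods:
  fixes a :: "nat \<Rightarrow> 'k::{metric_space, ab_group_add, topological_group_add}"
    and g :: "'k \<Rightarrow> 'a::real_normed_vector"
  assumes K: "compact (UNIV :: 'k set)"
    and hom: "\<And>m n. a (m + n) = a m + a n"
    and g: "continuous_on UNIV g" and e: "e > 0"
  shows "\<exists>Q>0. \<forall>m. \<exists>k\<in>{m..<m + Q}.
           (\<forall>n. norm (g (a (n + k)) - g (a n)) \<le> e) \<and> norm (cis (real k * \<theta>) - 1) \<le> e"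
proof -
  \<comment> \<open>Letting \<open>y\<close> range over the whole group, not only the orbit, makes
    \<open>close\<close> cancel translations: \<open>y - a m\<close> need not be of the form
    \<open>a n\<close>.\<close>
  define close where "close j k \<longleftrightarrow> (\<forall>y. norm (g (y + a j) - g (y + a k)) \<le> e) \<and>
      norm (cis (real j * \<theta>) - cis (real k * \<theta>)) \<le> e" for j k
  \<comment> \<open>Uniform continuity in both variables gives one \<open>\<delta>\<close> for all
    \<open>y\<close>, without a translation-invariant metric.\<close>
  have cont: "continuous_on UNIV (\<lambda>p::'k \<times> 'k. g (fst p + snd p))"
    by (rule continuous_on_compose2[OF g]) (auto intro!: continuous_intros)
  have "compact (UNIV :: ('k \<times> 'k) set)"
    using compact_Times[OF K K] by simp
  then have "uniformly_continuous_on UNIV (\<lambda>p::'k \<times> 'k. g (fst p + snd p))"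
    using cont by (rule compact_uniformly_continuous[rotated])
  then obtain \<delta> where \<delta>: "\<delta> > 0"
    "\<And>p q :: 'k \<times> 'k. dist q p < \<delta> \<Longrightarrow> dist (g (fst q + snd q)) (g (fst p + snd p)) < e"
    unfolding uniformly_continuous_on_def using e by (metis UNIV_I)
  have gd: "norm (g (y + x) - g (y + x')) \<le> e" if "dist x x' < \<delta>" for y x x'
    using \<delta>(2)[of "(y, x)" "(y, x')"] that by (simp add: dist_Pair_Pair dist_norm)
  \<comment> \<open>Halved because two points of the same colour are compared through the centre of
    their ball.\<close>
  define r where "r = min \<delta> e / 2"
  have r: "r > 0" using \<delta> e by (simp add: r_def)
  have "compact ((UNIV :: 'k set) \<times> cball (0::complex) 1)"
    using K by (intro compact_Times compact_cball)
  then obtain T where T: "finite T" "(UNIV :: 'k set) \<times> cball (0::complex) 1 \<subseteq> (\<Union>x\<in>T. ball x r)"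
    using r unfolding compact_eq_totally_bounded by blast
  define v where "v n = (a n, cis (real n * \<theta>))" for n
  have "\<exists>t\<in>T. dist t (v n) < r" for n
  proof -
    have "v n \<in> UNIV \<times> cball 0 1" by (simp add: v_def)
    then show ?thesis using T by (auto simp: subset_iff)
  qed
  then obtain c where c: "\<And>n. c n \<in> T" "\<And>n. dist (c n) (v n) < r" by metis
  have "\<exists>Q>0. \<forall>m. \<exists>k\<in>{m..<m + Q}. close k 0"
  proof (rule syndetic_of_finite_colouring)
    show "finite (range c)" using T c by (meson finite_subset image_subsetI)
    show "close j k" if "c j = c k" for j k
    proof -
      have d: "dist (v j) (v k) < min \<delta> e"
        using c(2)[of j] c(2)[of k] that dist_triangle3[of "v j" "v k" "c k"] by (simp add: r_def)
      then have "dist (a j) (a k) < \<delta>" "dist (cis (real j * \<theta>)) (cis (real k * \<theta>)) < e"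
        using dist_fst_le[of "v j" "v k"] dist_snd_le[of "v j" "v k"] by (simp_all add: v_def)
      then show ?thesis unfolding close_def using gd by (auto simp: dist_norm)
    qed
    show "close k j" if "close j k" for j k
      using that by (simp add: close_def norm_minus_commute)
    show "close j k" if "close (j + m) (k + m)" for j k m
    proof -
      have "norm (g (y + a j) - g (y + a k)) \<le> e" for y
      proof -
        have "norm (g ((y - a m) + a (j + m)) - g ((y - a m) + a (k + m))) \<le> e"
          using that unfolding close_def by blast
        then show ?thesis by (simp add: hom algebra_simps)
      qed
      moreover have "cis (real (j + m) * \<theta>) - cis (real (k + m) * \<theta>)
          = cis (real m * \<theta>) * (cis (real j * \<theta>) - cis (real k * \<theta>))"
        by (simp add: right_diff_distrib cis_mult algebra_simps)
      then have "norm (cis (real j * \<theta>) - cis (real k * \<theta>)) \<le> e"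
        using that unfolding close_def by (simp add: norm_mult)
      ultimately show ?thesis unfolding close_def by blast
    qed
  qed
  moreover have "a 0 = 0" using hom[of 0 0] by simp
  ultimately show ?thesis unfolding close_def hom by simp metis
qed

text \<open>The properties of integration against \<open>\<mu>\<close> that the orthogonality
  argument uses, stated on sequences so that no ultrafilters enter.\<close>

locale invariant_mean =
  fixes \<Lambda> :: "(nat \<Rightarrow> complex) \<Rightarrow> complex"
  assumes add: "bounded (range u) \<Longrightarrow> bounded (range v) \<Longrightarrow> \<Lambda> (\<lambda>n. u n + v n) = \<Lambda> u + \<Lambda> v"
    and scale: "bounded (range u) \<Longrightarrow> \<Lambda> (\<lambda>n. c * u n) = c * \<Lambda> u"
    and norm_le: "(\<And>n. norm (u n) \<le> C) \<Longrightarrow> norm (\<Lambda> u) \<le> C"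
    and shift: "bounded (range u) \<Longrightarrow> \<Lambda> (\<lambda>n. u (Suc n)) = \<Lambda> u"
begin

lemma diff:
  assumes "bounded (range u)" "bounded (range v)"
  shows "\<Lambda> (\<lambda>n. u n - v n) = \<Lambda> u - \<Lambda> v"
proof -
  have "bounded (range (\<lambda>n. - 1 * v n))"
    using assms(2) by (simp add: bounded_iff)
  then show ?thesis using add[OF assms(1), of "\<lambda>n. - 1 * v n"] scale[OF assms(2), of "- 1"] by simp
qed

lemma sum:
  assumes "\<And>i. i \<in> I \<Longrightarrow> bounded (range (u i))" "finite I"
  shows "\<Lambda> (\<lambda>n. \<Sum>i\<in>I. u i n) = (\<Sum>i\<in>I. \<Lambda> (u i)) \<and> bounded (range (\<lambda>n. \<Sum>i\<in>I. u i n))"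
  using assms(2,1)
proof (induction I rule: finite_induct)
  case empty
  have "norm (\<Lambda> (\<lambda>n. 0)) \<le> 0" by (rule norm_le) simp
  then show ?case by simp
next
  case (insert x F)
  then have "bounded (range (u x))" "bounded (range (\<lambda>n. \<Sum>i\<in>F. u i n))" by auto
  then have "bounded (range (\<lambda>n. u x n + (\<Sum>i\<in>F. u i n)))"
    by (rule bounded_plus_comp)
  then show ?case using insert add[of "u x" "\<lambda>n. \<Sum>i\<in>F. u i n"] by simp
qed

lemma shift_by:
  assumes "bounded (range u)"
  shows "\<Lambda> (\<lambda>n. u (n + k)) = \<Lambda> u"
proof (induction k)
  case (Suc k)
  have "bounded (range (\<lambda>n. u (n + k)))" using assms by (auto simp: bounded_iff)
  from shift[OF this] Suc show ?case by simp
qed simp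

end

section \<open>Exponential sums over windows\<close>

lemma sum_windows_diff:
  fixes s :: "nat \<Rightarrow> complex"
  assumes "\<And>i. norm (s i) \<le> D" "m \<le> k"
  shows "norm ((\<Sum>i<N. s (k + i)) - (\<Sum>i<N. s (m + i))) \<le> 2 * real (k - m) * D"
proof -
  have "norm ((\<Sum>i<N. s (m + j + i)) - (\<Sum>i<N. s (m + i))) \<le> 2 * real j * D" for j
  proof (induction j)
    case (Suc j)
    \<comment> \<open>Moving the window by one step drops its first term and adds one after its
      last.\<close>
    have "(\<Sum>i<N. s (m + Suc j + i)) - (\<Sum>i<N. s (m + j + i)) = s (m + j + N) - s (m + j)"
      using sum.lessThan_Suc_shift[of "\<lambda>i. s (m + j + i)" N] sum.lessThan_Suc[of "\<lambda>i. s (m + j + i)" N]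
      by (simp add: algebra_simps)
    moreover have "norm (s (m + j + N) - s (m + j)) \<le> D + D"
      by (rule norm_triangle_le_diff) (use assms in \<open>intro add_mono\<close>)
    ultimately have "norm ((\<Sum>i<N. s (m + Suc j + i)) - (\<Sum>i<N. s (m + j + i))) \<le> 2 * D" by simp
    then show ?case using Suc
      norm_triangle_ineq[of "(\<Sum>i<N. s (m + Suc j + i)) - (\<Sum>i<N. s (m + j + i))"
         "(\<Sum>i<N. s (m + j + i)) - (\<Sum>i<N. s (m + i))"]
      by (simp add: algebra_simps)
  qed simp
  from this[of "k - m"] show ?thesis using assms(2) by simp
qed

text \<open>The block starting at \<open>T * N\<close> is the windowed sum with
  \<open>l = T * N\<close> times a phase of modulus one.\<close>

lemma norm_sum_blocks:
  fixes s :: "nat \<Rightarrow> complex"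
  assumes "\<And>l. norm (\<Sum>i<N. cis (real i * \<theta>) * s (l + i)) \<le> c"
  shows "norm (\<Sum>i<T * N. cis (real i * \<theta>) * s i) \<le> real T * c"
proof (induction T)
  case (Suc T)
  have "(\<Sum>i<Suc T * N. cis (real i * \<theta>) * s i)
      = (\<Sum>i<T * N. cis (real i * \<theta>) * s i) + (\<Sum>i\<in>{T * N..<T * N + N}. cis (real i * \<theta>) * s i)"
    by (simp add: lessThan_atLeast0 sum.atLeastLessThan_concat add.commute)
  also have "(\<Sum>i\<in>{T * N..<T * N + N}. cis (real i * \<theta>) * s i)
      = (\<Sum>i<N. cis (real (T * N + i) * \<theta>) * s (T * N + i))"
    using sum.shift_bounds_nat_ivl[of "\<lambda>i. cis (real i * \<theta>) * s i" 0 "T * N" N]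
    by (simp add: lessThan_atLeast0 add.commute)
  also have "\<dots> = cis (real (T * N) * \<theta>) * (\<Sum>i<N. cis (real i * \<theta>) * s (T * N + i))"
    by (simp add: sum_distrib_left cis_mult distrib_right flip: mult.assoc)
  also have "norm ((\<Sum>i<T * N. cis (real i * \<theta>) * s i)
        + cis (real (T * N) * \<theta>) * (\<Sum>i<N. cis (real i * \<theta>) * s (T * N + i)))
     \<le> norm (\<Sum>i<T * N. cis (real i * \<theta>) * s i) + norm (cis (real (T * N) * \<theta>) * (\<Sum>i<N. cis (real i * \<theta>) * s (T * N + i)))"
    by (rule norm_triangle_ineq)
  also have "norm (cis (real (T * N) * \<theta>) * (\<Sum>i<N. cis (real i * \<theta>) * s (T * N + i))) \<le> c"
    using assms by (simp only: norm_mult norm_cis mult_1)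
  finally show ?case using Suc by (simp add: algebra_simps)
qed simp

text \<open>Compactness of the circle; a common multiple of finitely many window lengths inherits
  the bound of each of them.\<close>
lemma uniform_exponential_sums:
  fixes G :: "nat \<Rightarrow> complex"
  assumes M: "\<And>n. norm (G n) \<le> M"
    and pt: "\<And>\<theta> e. e > 0 \<Longrightarrow> \<exists>N>0. \<forall>l. norm (\<Sum>i<N. cis (real i * \<theta>) * G (l + i)) \<le> e * real N"
    and e: "e > 0"
  shows "\<exists>N>0. \<forall>T \<theta>. norm (\<Sum>i<T * N. cis (real i * \<theta>) * G i) \<le> e * real (T * N)"
proof -
  have M0: "M \<ge> 0" using M[of 0] norm_ge_zero order_trans by blast
  have "\<forall>x. \<exists>N>0. \<forall>l. norm (\<Sum>i<N. cis (real i * (2 * pi * x)) * G (l + i)) \<le> e / 2 * real N"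
    using pt[of "e / 2"] e by simp
  then obtain n where n: "\<And>x. n x > 0"
    "\<And>x l. norm (\<Sum>i<n x. cis (real i * (2 * pi * x)) * G (l + i)) \<le> e / 2 * real (n x)"
    by metis
  \<comment> \<open>Within this distance each phase moves by at most
    \<open>2 pi (r x) (n x)\<close>, hence the sum by at most \<open>e / 2 * n x\<close>. The
    \<open>+ 1\<close> keeps the denominator positive when \<open>M = 0\<close>.\<close>
  define r where "r x = e / (4 * pi * (M + 1) * real (n x))" for x
  have r: "r x > 0" for x using e M0 n by (simp add: r_def)
  have near: "norm (\<Sum>i<n x. cis (real i * (2 * pi * y)) * G (l + i)) \<le> e * real (n x)"
    if "y \<in> ball x (r x)" for x y l
  proof -
    have "norm ((\<Sum>i<n x. cis (real i * (2 * pi * y)) * G (l + i)) - (\<Sum>i<n x. cis (real i * (2 * pi * x)) * G (l + i)))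
        = norm (\<Sum>i<n x. (cis (real i * (2 * pi * y)) - cis (real i * (2 * pi * x))) * G (l + i))"
      by (simp add: sum_subtractf left_diff_distrib)
    also have "\<dots> \<le> (\<Sum>i<n x. (real (n x) * (2 * pi * r x)) * (M + 1))"
    proof (rule sum_norm_le)
      fix i assume i: "i \<in> {..<n x}"
      have "norm (cis (real i * (2 * pi * y)) - cis (real i * (2 * pi * x)))
          \<le> \<bar>real i * (2 * pi * y) - real i * (2 * pi * x)\<bar>" by (rule norm_cis_diff_le)
      also have "\<dots> = real i * (2 * pi * \<bar>y - x\<bar>)"
        by (simp add: abs_mult flip: right_diff_distrib)
      also have "\<dots> \<le> real (n x) * (2 * pi * r x)"
        using that i by (intro mult_mono) (auto simp: dist_real_def)
      finally show "norm ((cis (real i * (2 * pi * y)) - cis (real i * (2 * pi * x))) * G (l + i))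
          \<le> (real (n x) * (2 * pi * r x)) * (M + 1)"
        unfolding norm_mult using M[of "l + i"] r[of x] by (intro mult_mono) auto
    qed
    also have "\<dots> = e / 2 * real (n x)"
    proof -
      have "4 * pi * (M + 1) * real (n x) \<noteq> 0" using n[of x] M0 by simp
      then have "r x * (4 * pi * (M + 1) * real (n x)) = e" unfolding r_def by (metis nonzero_mult_div_cancel_right times_divide_eq_left)
      then have "real (n x) * (r x * (4 * pi * (M + 1) * real (n x))) / 2 = e / 2 * real (n x)" by simp
      then show ?thesis by (simp add: algebra_simps)
    qed
    finally have "norm ((\<Sum>i<n x. cis (real i * (2 * pi * y)) * G (l + i)) - (\<Sum>i<n x. cis (real i * (2 * pi * x)) * G (l + i)))
       \<le> e / 2 * real (n x)" .
    then show ?thesis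
      using n(2)[of x l] norm_triangle_sub[of "\<Sum>i<n x. cis (real i * (2 * pi * y)) * G (l + i)" "\<Sum>i<n x. cis (real i * (2 * pi * x)) * G (l + i)"]
      by (simp add: algebra_simps)
  qed
  have "{0..1} \<subseteq> (\<Union>x\<in>{0..1}. ball x (r x))" using r by auto
  then obtain X where X: "X \<subseteq> {0..1}" "finite X" "{0..1} \<subseteq> (\<Union>x\<in>X. ball x (r x))"
    using compactE_image[OF compact_Icc[of "0::real" 1], of "{0..1}" "\<lambda>x. ball x (r x)"] by (metis open_ball)
  define N where "N = prod n X"
  have "norm (\<Sum>i<T * N. cis (real i * \<theta>) * G i) \<le> e * real (T * N)" for T \<theta>
  proof -
    define y where "y = frac (\<theta> / (2 * pi))"
    have cis_y: "cis (real i * \<theta>) = cis (real i * (2 * pi * y))" for i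
      unfolding y_def cis_mult_frac by simp
    have "y \<in> {0..1}" using frac_lt_1[of "\<theta> / (2 * pi)"] by (simp add: y_def)
    then obtain x where x: "x \<in> X" "y \<in> ball x (r x)" using X by blast
    have "n x dvd N" unfolding N_def using X x by (intro dvd_prodI)
    then obtain q where q: "N = q * n x" by (metis dvd_def mult.commute)
    have "norm (\<Sum>i<(T * q) * n x. cis (real i * (2 * pi * y)) * G i) \<le> real (T * q) * (e * real (n x))"
      by (rule norm_sum_blocks) (rule near[OF x(2)])
    moreover have "(T * q) * n x = T * N" by (simp add: q)
    moreover have "real (T * q) * (e * real (n x)) = e * real (T * N)" by (simp add: q)
    ultimately show ?thesis unfolding cis_y by metis
  qed
  moreover have "N > 0" unfolding N_def using n by (simp add: prod_pos)
  ultimately show ?thesis by blast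
qed

context invariant_mean
begin

text \<open>The sequence \<open>G\<close> below meets the hypotheses of
  \<open>vanishing_of_null_spectrum\<close>: it inherits the almost periods of \<open>b\<close>, and
  its exponential averages are small because a long window sum of
  \<open>cis (i \<theta>) * b i\<close> hardly depends on where the window starts, while
  \<open>\<Lambda>\<close> annihilates \<open>f\<close> times an exponential.\<close>

lemma orthogonal_almost_periodic:
  fixes f b :: "nat \<Rightarrow> complex"
  assumes f: "\<And>n. norm (f n) \<le> C" and b: "\<And>n. norm (b n) \<le> D"
    and orth: "\<And>\<theta>. \<Lambda> (\<lambda>n. f n * cis (real n * \<theta>)) = 0"
    and per: "\<And>\<theta> e. e > 0 \<Longrightarrow> \<exists>Q>0. \<forall>m. \<exists>k\<in>{m..<m + Q}.
               (\<forall>n. norm (b (n + k) - b n) \<le> e) \<and> norm (cis (real k * \<theta>) - 1) \<le> e"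
  shows "\<Lambda> (\<lambda>n. f n * b n) = 0"
proof -
  have C: "C \<ge> 0" and D: "D \<ge> 0" using f[of 0] b[of 0] norm_ge_zero order_trans by blast+
  have bdd: "bounded (range (\<lambda>n. f n * v n))" if "\<And>n. norm (v n) \<le> E" for v E
    unfolding bounded_iff using that f C by (auto simp: norm_mult intro!: exI[of _ "C * E"] mult_mono)
  have small: "norm (\<Lambda> (\<lambda>n. f n * v n)) \<le> C * E" if "\<And>n. norm (v n) \<le> E" for v E
    by (rule norm_le) (use that f C in \<open>auto simp: norm_mult intro!: mult_mono\<close>)
  define G where "G k = \<Lambda> (\<lambda>n. f n * b (n + k))" for k
  have GM: "norm (G k) \<le> C * D" for k
    unfolding G_def by (rule small) (rule b)
  have G_diff: "norm (G (n + k) - G n) \<le> C * E" if "\<And>n. norm (b (n + k) - b n) \<le> E" for n k E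
  proof -
    have "G (n + k) - G n = \<Lambda> (\<lambda>j. f j * (b (j + (n + k)) - b (j + n)))"
      unfolding G_def by (subst diff[symmetric]) (auto intro!: bdd b simp: right_diff_distrib)
    then show ?thesis using small[of "\<lambda>j. b (j + (n + k)) - b (j + n)" E] that
      by (simp add: add.assoc[symmetric])
  qed
  have ap: "syndetic_periods G"
    unfolding syndetic_periods_def
  proof (intro allI impI)
    fix e :: real assume e: "e > 0"
    then obtain Q where Q: "Q > 0"
      "\<And>m. \<exists>k\<in>{m..<m + Q}. (\<forall>n. norm (b (n + k) - b n) \<le> e / (C + 1))"
      using per[of "e / (C + 1)" 0] C by (auto simp: divide_pos_pos)
    have "C * (e / (C + 1)) \<le> e" using e C by (simp add: field_simps)
    then show "\<exists>Q>0. \<forall>m. \<exists>k\<in>{m..<m + Q}. \<forall>n. norm (G (n + k) - G n) \<le> e"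
      using Q G_diff by (meson order_trans)
  qed
  have pt: "\<exists>N>0. \<forall>l. norm (\<Sum>i<N. cis (real i * \<theta>) * G (l + i)) \<le> e * real N" if e: "e > 0" for \<theta> e
  proof -
    define s where "s i = cis (real i * \<theta>) * b i" for i
    have s: "norm (s i) \<le> D" for i using b by (simp add: s_def norm_mult)
    \<comment> \<open>\<open>e2\<close> absorbs the factor \<open>C\<close> coming from
      \<open>f\<close>; \<open>e1\<close> is then chosen so that
      \<open>e1 * (1 + D) = e2 / 2\<close>.\<close>
    define e2 where "e2 = e / (C + 1)"
    have e2: "e2 > 0" using e C by (simp add: e2_def)
    define e1 where "e1 = e2 / (2 * (1 + D))"
    have e1: "e1 > 0" using e2 D by (simp add: e1_def)
    obtain Q where Q: "Q > 0" "\<And>m. \<exists>k\<in>{m..<m + Q}.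
        (\<forall>n. norm (b (n + k) - b n) \<le> e1) \<and> norm (cis (real k * \<theta>) - 1) \<le> e1"
      using per[OF e1, of \<theta>] by blast
    \<comment> \<open>Long enough that moving the window by fewer than \<open>Q\<close> steps costs
      at most \<open>e2 * N / 2\<close>.\<close>
    obtain N :: nat where N: "real N > 4 * real Q * D / e2" using reals_Archimedean2 by blast
    have "4 * real Q * D / e2 \<ge> 0" using D e2 by simp
    then have N0: "N > 0" using N by linarith
    define \<gamma> where "\<gamma> m = (\<Sum>i<N. s (m + i))" for m
    \<comment> \<open>The window at \<open>m\<close> is compared with the one at a nearby almost
      period \<open>k\<close>, which agrees with the window at \<open>0\<close> term by term up to a
      small error.\<close>
    have \<gamma>: "norm (\<gamma> m - \<gamma> 0) \<le> e2 * real N" for m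
    proof -
      obtain k where k: "k \<in> {m..<m + Q}" "\<And>n. norm (b (n + k) - b n) \<le> e1"
        "norm (cis (real k * \<theta>) - 1) \<le> e1" using Q by blast
      have "norm (\<gamma> k - \<gamma> m) \<le> 2 * real (k - m) * D"
        unfolding \<gamma>_def by (rule sum_windows_diff[OF s]) (use k in auto)
      also have "\<dots> \<le> 2 * real Q * D" using k D by (intro mult_right_mono) auto
      also have "\<dots> \<le> e2 * real N / 2" using N e2 by (simp add: field_simps)
      finally have 1: "norm (\<gamma> k - \<gamma> m) \<le> e2 * real N / 2" .
      have "norm (\<gamma> k - \<gamma> 0) = norm (\<Sum>i<N. s (k + i) - s i)" by (simp add: \<gamma>_def sum_subtractf)
      also have "\<dots> \<le> (\<Sum>i<N. e1 * (1 + D))"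
      proof (rule sum_norm_le)
        fix i
        have "s (k + i) - s i = cis (real (k + i) * \<theta>) * (b (i + k) - b i)
            + cis (real i * \<theta>) * (cis (real k * \<theta>) - 1) * b i"
          by (simp add: s_def cis_mult algebra_simps)
        also have "norm \<dots> \<le> norm (cis (real (k + i) * \<theta>) * (b (i + k) - b i))
            + norm (cis (real i * \<theta>) * (cis (real k * \<theta>) - 1) * b i)" by (rule norm_triangle_ineq)
        also have "\<dots> = norm (b (i + k) - b i) + norm (cis (real k * \<theta>) - 1) * norm (b i)"
          by (simp add: norm_mult)
        also have "\<dots> \<le> e1 + e1 * D"
          using k b e1 by (intro add_mono mult_mono) auto
        finally show "norm (s (k + i) - s i) \<le> e1 * (1 + D)" by (simp add: algebra_simps)
      qed
      also have "\<dots> = e2 * real N / 2"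
      proof -
        have "1 + D \<noteq> 0" using D by simp
        then show ?thesis by (simp add: e1_def field_simps)
      qed
      finally have 2: "norm (\<gamma> k - \<gamma> 0) \<le> e2 * real N / 2" .
      show ?thesis using 1 2 norm_triangle_ineq4[of "\<gamma> k - \<gamma> 0" "\<gamma> k - \<gamma> m"] by simp
    qed
    have "norm (\<Sum>i<N. cis (real i * \<theta>) * G (l + i)) \<le> e * real N" for l
    proof -
      define d where "d n = cis (- (real (n + l) * \<theta>)) * (\<gamma> (n + l) - \<gamma> 0)" for n
      have d: "norm (d n) \<le> e2 * real N" for n using \<gamma> by (simp add: d_def norm_mult)
      \<comment> \<open>Up to a phase the sum is \<open>f n * \<gamma> (n + l)\<close>. Replacing
        \<open>\<gamma> (n + l)\<close> by \<open>\<gamma> 0\<close> leaves the small error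
        \<open>d n\<close> and a constant multiple of \<open>f n * cis (n (- \<theta>))\<close>,
        which \<open>orth\<close> kills.\<close>
      have pointwise: "(\<Sum>i<N. cis (real i * \<theta>) * (f n * b (n + (l + i))))
          = f n * d n + (\<gamma> 0 * cis (- (real l * \<theta>))) * (f n * cis (real n * (- \<theta>)))" for n
      proof -
        have "cis (real i * \<theta>) * b (n + (l + i)) = cis (- (real (n + l) * \<theta>)) * s (n + l + i)" for i
          unfolding s_def mult.assoc[symmetric] cis_mult by (simp add: algebra_simps)
        then have "(\<Sum>i<N. cis (real i * \<theta>) * (f n * b (n + (l + i))))
            = f n * (cis (- (real (n + l) * \<theta>)) * \<gamma> (n + l))"
          by (simp add: \<gamma>_def sum_distrib_left mult.left_commute)
        also have "\<dots> = f n * d n + f n * (cis (- (real (n + l) * \<theta>)) * \<gamma> 0)"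
          by (simp add: d_def algebra_simps)
        also have "cis (- (real (n + l) * \<theta>)) = cis (- (real l * \<theta>)) * cis (real n * (- \<theta>))"
          by (simp add: cis_mult algebra_simps)
        finally show ?thesis by (simp add: mult_ac)
      qed
      have bi: "bounded (range (\<lambda>n. f n * b (n + (l + i))))" for i by (rule bdd) (rule b)
      have "bounded (range (\<lambda>n. cis (real i * \<theta>) * (f n * b (n + (l + i)))))" for i
        using bi[of i] by (auto simp: bounded_iff norm_mult)
      then have "(\<Sum>i<N. cis (real i * \<theta>) * G (l + i))
          = \<Lambda> (\<lambda>n. \<Sum>i<N. cis (real i * \<theta>) * (f n * b (n + (l + i))))"
        by (subst sum[THEN conjunct1]) (auto simp: G_def scale[OF bi])
      also have "\<dots> = \<Lambda> (\<lambda>n. f n * d n)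
          + \<Lambda> (\<lambda>n. (\<gamma> 0 * cis (- (real l * \<theta>))) * (f n * cis (real n * (- \<theta>))))"
        unfolding pointwise
      proof (rule add)
        show "bounded (range (\<lambda>n. f n * d n))" by (rule bdd) (rule d)
        have "bounded (range (\<lambda>n. f n * ((\<gamma> 0 * cis (- (real l * \<theta>))) * cis (real n * (- \<theta>)))))"
          by (rule bdd[of _ "norm (\<gamma> 0)"]) (simp add: norm_mult)
        then show "bounded (range (\<lambda>n. (\<gamma> 0 * cis (- (real l * \<theta>))) * (f n * cis (real n * (- \<theta>)))))"
          by (simp only: mult.left_commute)
      qed
      also have "\<Lambda> (\<lambda>n. (\<gamma> 0 * cis (- (real l * \<theta>))) * (f n * cis (real n * (- \<theta>)))) = 0"
        by (subst scale) (auto simp only: orth mult_zero_right intro!: bdd[of _ 1] norm_cis[THEN eq_refl])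
      finally have "norm (\<Sum>i<N. cis (real i * \<theta>) * G (l + i)) \<le> C * (e2 * real N)"
        using small[OF d] by simp
      also have "\<dots> \<le> e * real N"
        using C e by (simp add: e2_def field_simps mult_left_mono)
      finally show ?thesis .
    qed
    then show ?thesis using N0 by blast
  qed
  have "G 0 = 0"
    by (rule vanishing_of_null_spectrum[OF GM ap]) (rule uniform_exponential_sums[OF GM pt])
  then show ?thesis by (simp add: G_def)
qed

end

section \<open>Integration on the space of ultrafilters\<close>

text \<open>\<open>Lim\<close> is meaningful only where a limit exists. Compactness of the closure
  gives a cluster point of the image of \<open>p\<close>, and the image of an ultrafilter converges
  to each of its cluster points.\<close>

lemma tendsto_Lim_ultrafilter:
  fixes u :: "'a \<Rightarrow> 'b::heine_borel"
  assumes p: "ultrafilter p" and u: "bounded (range u)"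
  shows "(u \<longlongrightarrow> Lim p u) p"
proof -
  have "p \<noteq> bot" using p by (simp add: ultrafilter_def)
  have "compact (closure (range u))" using u by (simp add: compact_closure)
  moreover have "filtermap u p \<noteq> bot" using \<open>p \<noteq> bot\<close> by (simp add: filtermap_bot_iff)
  moreover have "eventually (\<lambda>x. x \<in> closure (range u)) (filtermap u p)"
    by (auto simp: eventually_filtermap intro!: always_eventually closure_subset[THEN subsetD])
  ultimately obtain x where x: "inf (nhds x) (filtermap u p) \<noteq> bot"
    unfolding compact_filter by blast
  have "(u \<longlongrightarrow> x) p"
    unfolding filterlim_def le_filter_def
  proof (intro allI impI)
    fix P assume P: "eventually P (nhds x)"
    show "eventually P (filtermap u p)"
    proof (rule ccontr)
      assume "\<not> eventually P (filtermap u p)"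
      then have "eventually (\<lambda>y. \<not> P y) (filtermap u p)"
        using p unfolding ultrafilter_def eventually_filtermap by metis
      then have "eventually (\<lambda>_. False) (inf (nhds x) (filtermap u p))"
        using P unfolding eventually_inf by fast
      then show False using x by (simp add: trivial_limit_def)
    qed
  qed
  then show ?thesis using tendsto_Lim \<open>p \<noteq> bot\<close> by metis
qed

lemma Lim_ultrafilter_eqI: "ultrafilter p \<Longrightarrow> (u \<longlongrightarrow> l) p \<Longrightarrow> Lim p u = l"
  by (simp add: tendsto_Lim ultrafilter_def)

lemma topspace_betaN: "topspace betaN = {p. ultrafilter p}"
  by (auto simp: betaN_def clb_def intro!: exI[of _ UNIV])

lemma openin_clb: "openin betaN (clb A)"
  unfolding betaN_def by (rule topology_generated_by_Basis) simp

lemma ultrafilter_pu: "ultrafilter (pu n)"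
  by (auto simp: ultrafilter_def pu_def eventually_principal principal_eq_bot_iff)

lemma Lim_pu: "Lim (pu n) u = u n"
  by (rule Lim_ultrafilter_eqI[OF ultrafilter_pu])
     (auto simp: pu_def tendsto_def eventually_principal)

text \<open>Points \<open>q\<close> near \<open>p\<close> contain the set on which \<open>u\<close>
  is close to \<open>Lim p u\<close>, and this confines \<open>Lim q u\<close>.\<close>

lemma continuous_map_Lim:
  fixes u :: "nat \<Rightarrow> 'b::heine_borel"
  assumes u: "bounded (range u)"
  shows "continuous_map betaN euclidean (\<lambda>p. Lim p u)"
  unfolding continuous_map_def
proof (intro conjI allI impI)
  fix V :: "'b set" assume "openin euclidean V"
  then have V: "open V" by simp
  show "openin betaN {p \<in> topspace betaN. Lim p u \<in> V}"
  proof (subst openin_subopen, safe)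
    fix p assume p: "p \<in> topspace betaN" "Lim p u \<in> V"
    \<comment> \<open>A closed ball, because the strict inequality in \<open>A\<close> survives the
      limit along \<open>q\<close> only as a weak one.\<close>
    obtain e where e: "e > 0" "cball (Lim p u) e \<subseteq> V" using V p open_contains_cball by blast
    define A where "A = {n. dist (u n) (Lim p u) < e}"
    have up: "ultrafilter p" using p by (simp add: topspace_betaN)
    have "eventually (\<lambda>n. n \<in> A) p"
      unfolding A_def mem_Collect_eq using tendsto_Lim_ultrafilter[OF up u] e(1) by (rule tendstoD)
    then have "p \<in> clb A" using up by (simp add: clb_def)
    moreover have "clb A \<subseteq> {p \<in> topspace betaN. Lim p u \<in> V}"
    proof safe
      fix q assume q: "q \<in> clb A"
      then have uq: "ultrafilter q" by (simp add: clb_def)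
      then show "q \<in> topspace betaN" by (simp add: topspace_betaN)
      have "eventually (\<lambda>n. u n \<in> cball (Lim p u) e) q"
        using q by (auto simp: clb_def A_def dist_commute elim!: eventually_mono)
      then have "Lim q u \<in> cball (Lim p u) e"
        using tendsto_Lim_ultrafilter[OF uq u] uq
        by (intro Lim_in_closed_set[where F = q]) (auto simp: ultrafilter_def)
      then show "Lim q u \<in> V" using e by blast
    qed
    ultimately show "\<exists>T. openin betaN T \<and> p \<in> T \<and> T \<subseteq> {p \<in> topspace betaN. Lim p u \<in> V}"
      using openin_clb by blast
  qed
qed simp

section \<open>Borel sets of a topology\<close>

lemma space_borel_of: "space (borel_of X) = topspace X"
  by (simp add: borel_of_def space_measure_of_conv)

lemma openin_imp_borel_of: "openin X U \<Longrightarrow> U \<in> sets (borel_of X)"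
  unfolding borel_of_def
  by (subst sets_measure_of) (auto dest: openin_subset)

lemma continuous_map_borel_measurable:
  fixes g :: "'a \<Rightarrow> 'b::topological_space"
  assumes "continuous_map X euclidean g"
  shows "g \<in> borel_measurable (borel_of X)"
proof (rule borel_measurableI)
  fix V :: "'b set" assume "open V"
  then have "openin X {x \<in> topspace X. g x \<in> V}"
    using assms by (auto simp: continuous_map_def)
  moreover have "{x \<in> topspace X. g x \<in> V} = g -` V \<inter> space (borel_of X)"
    by (auto simp: space_borel_of)
  ultimately show "g -` V \<inter> space (borel_of X) \<in> sets (borel_of X)"
    using openin_imp_borel_of by metis
qed

lemma norm_Lim_le:
  fixes u :: "nat \<Rightarrow> 'b::euclidean_space"
  assumes "ultrafilter p" "\<And>n. norm (u n) \<le> C"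
  shows "norm (Lim p u) \<le> C"
proof -
  have "bounded (range u)" using assms(2) by (auto simp: bounded_iff)
  then have "((\<lambda>n. norm (u n)) \<longlongrightarrow> norm (Lim p u)) p"
    using assms(1) tendsto_Lim_ultrafilter tendsto_norm by blast
  then show ?thesis
    by (rule tendsto_upperbound) (use assms in \<open>auto simp: ultrafilter_def\<close>)
qed

lemma Lim_bounded_linear:
  fixes u :: "nat \<Rightarrow> 'b::euclidean_space" and T :: "'b \<Rightarrow> 'c::euclidean_space"
  assumes "bounded_linear T" "bounded (range u)" "ultrafilter p"
  shows "Lim p (\<lambda>n. T (u n)) = T (Lim p u)"
  using assms by (intro Lim_ultrafilter_eqI bounded_linear.tendsto[OF assms(1)] tendsto_Lim_ultrafilter)

section \<open>Integration of extended sequences against a probability measure\<close>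

locale betaN_prob =
  fixes \<mu> :: "nat filter measure"
  assumes sets_mu: "sets \<mu> = sets (borel_of betaN)" and prob: "prob_space \<mu>"

sublocale betaN_prob \<subseteq> prob_space \<mu>
  by (rule prob)

context betaN_prob
begin

lemma space_mu: "space \<mu> = {p. ultrafilter p}"
  using sets_eq_imp_space_eq[OF sets_mu] by (simp add: space_borel_of topspace_betaN)

lemma Lim_measurable:
  fixes u :: "nat \<Rightarrow> 'b::euclidean_space"
  shows "bounded (range u) \<Longrightarrow> (\<lambda>p. Lim p u) \<in> borel_measurable \<mu>"
  using continuous_map_borel_measurable[OF continuous_map_Lim]
    measurable_cong_sets[OF sets_mu refl] by blast

lemma Lim_integrable:
  fixes u :: "nat \<Rightarrow> 'b::euclidean_space"
  assumes "bounded (range u)"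
  shows "integrable \<mu> (\<lambda>p. Lim p u)"
proof -
  obtain C where "\<And>n. norm (u n) \<le> C" using assms by (auto simp: bounded_iff)
  then have "AE p in \<mu>. norm (Lim p u) \<le> C"
    by (intro AE_I2 norm_Lim_le) (simp_all add: space_mu)
  then show ?thesis
    by (rule integrable_const_bound) (rule Lim_measurable[OF assms])
qed

definition mean :: "(nat \<Rightarrow> 'b::euclidean_space) \<Rightarrow> 'b" where
  "mean u = (\<integral>p. Lim p u \<partial>\<mu>)"

text \<open>Used with \<open>Re\<close>, \<open>Im\<close>, \<open>of_real\<close> and
  multiplication by a constant, to pass between real and complex sequences and to get
  homogeneity.\<close>

lemma mean_bounded_linear:
  fixes u :: "nat \<Rightarrow> 'b::euclidean_space" and T :: "'b \<Rightarrow> 'c::euclidean_space"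
  assumes T: "bounded_linear T" and u: "bounded (range u)"
  shows "mean (\<lambda>n. T (u n)) = T (mean u)"
proof -
  have "mean (\<lambda>n. T (u n)) = (\<integral>p. T (Lim p u) \<partial>\<mu>)"
    unfolding mean_def
    by (rule Bochner_Integration.integral_cong) (auto simp: space_mu Lim_bounded_linear[OF T u])
  also have "\<dots> = T (mean u)"
    unfolding mean_def by (rule integral_bounded_linear[OF T Lim_integrable[OF u]])
  finally show ?thesis .
qed

lemma mean_add:
  fixes u v :: "nat \<Rightarrow> 'b::euclidean_space"
  assumes "bounded (range u)" "bounded (range v)"
  shows "mean (\<lambda>n. u n + v n) = mean u + mean v"
proof -
  have "mean (\<lambda>n. u n + v n) = (\<integral>p. Lim p u + Lim p v \<partial>\<mu>)"
    unfolding mean_def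
    by (rule Bochner_Integration.integral_cong)
       (auto simp: space_mu intro!: Lim_ultrafilter_eqI tendsto_add tendsto_Lim_ultrafilter assms)
  then show ?thesis
    unfolding mean_def by (simp add: Lim_integrable assms)
qed

lemma norm_mean_le:
  fixes u :: "nat \<Rightarrow> 'b::euclidean_space"
  assumes "\<And>n. norm (u n) \<le> C"
  shows "norm (mean u) \<le> C"
proof -
  have b: "bounded (range u)" using assms by (auto simp: bounded_iff)
  have "norm (mean u) \<le> (\<integral>p. norm (Lim p u) \<partial>\<mu>)"
    unfolding mean_def by (rule integral_norm_bound)
  also have "\<dots> \<le> C"
    by (intro integral_le_const integrable_norm Lim_integrable[OF b] AE_I2 norm_Lim_le)
       (simp_all add: space_mu assms)
  finally show ?thesis .
qed

lemma mean_ge: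
  fixes u :: "nat \<Rightarrow> real"
  assumes b: "bounded (range u)" and "\<And>n. c \<le> u n"
  shows "c \<le> mean u"
  unfolding mean_def
proof (rule integral_ge_const[OF Lim_integrable[OF b]], rule AE_I2)
  fix p assume "p \<in> space \<mu>"
  then have p: "ultrafilter p" by (simp add: space_mu)
  show "c \<le> Lim p u"
    by (rule tendsto_lowerbound[OF tendsto_Lim_ultrafilter[OF p b]])
       (use assms p in \<open>auto simp: ultrafilter_def\<close>)
qed

end

section \<open>Means given by measures in \<open>Mset \<Psi>\<close>\<close>

lemma betaN_prob_Mset: "\<mu> \<in> Mset \<Psi> \<Longrightarrow> betaN_prob \<mu>"
  by (auto simp: Mset_def radon_prob_def betaN_prob_def)

text \<open>The weak* condition is tested on the single continuous function
  \<open>\<lambda>p. Lim p u\<close>, whose value at \<open>pu n\<close> is \<open>u n\<close>, at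
  some \<open>N\<close> beyond \<open>N0\<close>.\<close>

lemma mean_eq_limit_real:
  fixes u :: "nat \<Rightarrow> real"
  assumes \<mu>: "\<mu> \<in> Mset \<Psi>" and u: "bounded (range u)" and lim: "(\<lambda>N. avg \<Psi> N u) \<longlonglongrightarrow> c"
  shows "betaN_prob.mean \<mu> u = c"
proof -
  interpret betaN_prob \<mu> by (rule betaN_prob_Mset[OF \<mu>])
  have "\<bar>mean u - c\<bar> \<le> e" if e: "e > 0" for e
  proof -
    obtain N0 where N0: "\<And>N. N \<ge> N0 \<Longrightarrow> \<bar>avg \<Psi> N u - c\<bar> < e / 2"
      using LIMSEQ_D[OF lim, of "e / 2"] e by auto
    have "\<forall>G::(nat filter \<Rightarrow> real) set. \<forall>\<epsilon>>0. \<forall>N0.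
        finite G \<and> (\<forall>g\<in>G. continuous_map betaN euclideanreal g) \<longrightarrow>
        (\<exists>N\<ge>N0. \<forall>g\<in>G. \<bar>(\<integral>x. g x \<partial>\<mu>) - avg \<Psi> N (\<lambda>n. g (pu n))\<bar> < \<epsilon>)"
      using \<mu> by (simp add: Mset_def)
    from this[rule_format, of "e / 2" "{\<lambda>p. Lim p u}" N0]
    obtain N where "N \<ge> N0" "\<bar>(\<integral>p. Lim p u \<partial>\<mu>) - avg \<Psi> N u\<bar> < e / 2"
      using e continuous_map_Lim[OF u] by (auto simp: Lim_pu)
    with N0[of N] show ?thesis unfolding mean_def by linarith
  qed
  then have "\<bar>mean u - c\<bar> \<le> 0" by (rule field_le_epsilon[of _ 0, simplified])
  then show ?thesis by simp
qed

lemma mean_eq_limit: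
  fixes u :: "nat \<Rightarrow> complex"
  assumes \<mu>: "\<mu> \<in> Mset \<Psi>" and u: "bounded (range u)" and lim: "(\<lambda>N. avg \<Psi> N u) \<longlonglongrightarrow> c"
  shows "betaN_prob.mean \<mu> u = c"
proof -
  interpret betaN_prob \<mu> by (rule betaN_prob_Mset[OF \<mu>])
  have "bounded (range (\<lambda>n. Re (u n)))" "bounded (range (\<lambda>n. Im (u n)))"
    using bounded_linear_image[OF u bounded_linear_Re] bounded_linear_image[OF u bounded_linear_Im]
    by (simp_all add: image_image)
  moreover have "(\<lambda>N. avg \<Psi> N (\<lambda>n. Re (u n))) \<longlonglongrightarrow> Re c" "(\<lambda>N. avg \<Psi> N (\<lambda>n. Im (u n))) \<longlonglongrightarrow> Im c"
    using tendsto_Re[OF lim] tendsto_Im[OF lim] by (simp_all add: avg_def)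
  ultimately have "mean (\<lambda>n. Re (u n)) = Re c" "mean (\<lambda>n. Im (u n)) = Im c"
    using mean_eq_limit_real[OF \<mu>] by blast+
  then show ?thesis
    using mean_bounded_linear[OF bounded_linear_Re u] mean_bounded_linear[OF bounded_linear_Im u]
    by (simp add: complex_eq_iff)
qed

lemma norm_avg_le:
  fixes g :: "nat \<Rightarrow> 'a::real_normed_field"
  assumes "foelner \<Psi>" "\<And>n. norm (g n) \<le> C"
  shows "norm (avg \<Psi> N g) \<le> C"
proof -
  have "finite (\<Psi> N)" "\<Psi> N \<noteq> {}" using assms(1) by (auto simp: foelner_def)
  then have "card (\<Psi> N) > 0" by (simp add: card_gt_0_iff)
  moreover have "norm (sum g (\<Psi> N)) \<le> real (card (\<Psi> N)) * C"
    by (rule order_trans[OF sum_norm_le[of _ _ "\<lambda>_. C"]]) (use assms in auto)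
  ultimately show ?thesis by (simp add: avg_def norm_divide divide_le_eq mult.commute)
qed

text \<open>The sums over \<open>\<Psi> N\<close> and its translate by \<open>1\<close> cancel
  outside their symmetric difference, whose relative size tends to \<open>0\<close>.\<close>

lemma avg_shift_diff:
  fixes u :: "nat \<Rightarrow> 'a::real_normed_field"
  assumes F: "foelner \<Psi>" and u: "\<And>n. norm (u n) \<le> C"
  shows "(\<lambda>N. avg \<Psi> N (\<lambda>n. u (Suc n) - u n)) \<longlonglongrightarrow> 0"
proof (rule Lim_null_comparison)
  define \<rho> where "\<rho> N = real (card ((((+) 1) ` \<Psi> N - \<Psi> N) \<union> (\<Psi> N - ((+) 1) ` \<Psi> N))) / real (card (\<Psi> N))" for N
  have "\<rho> \<longlonglongrightarrow> 0"
    using F unfolding foelner_def \<rho>_def by blast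
  then show "(\<lambda>N. C * \<rho> N) \<longlonglongrightarrow> 0"
    by (rule tendsto_mult_right_zero)
  have "norm (avg \<Psi> N (\<lambda>n. u (Suc n) - u n)) \<le> C * \<rho> N" for N
  proof -
    define A where "A = \<Psi> N"
    define A' where "A' = (+) 1 ` A"
    have fin: "finite A" "finite A'" using F by (auto simp: foelner_def A_def A'_def)
    have "(\<Sum>n\<in>A. u (Suc n) - u n) = sum u A' - sum u A"
      unfolding A'_def by (subst sum.reindex) (auto simp: sum_subtractf)
    also have "\<dots> = sum u (A' - A) - sum u (A - A')"
      using sum.Int_Diff[OF fin(1), of u A'] sum.Int_Diff[OF fin(2), of u A] by (simp add: Int_commute)
    finally have "norm (\<Sum>n\<in>A. u (Suc n) - u n) \<le> norm (sum u (A' - A)) + norm (sum u (A - A'))"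
      by (simp add: norm_triangle_ineq4)
    also have "\<dots> \<le> (\<Sum>n\<in>A' - A. C) + (\<Sum>n\<in>A - A'. C)"
      by (intro add_mono sum_norm_le u)
    also have "\<dots> = C * real (card ((A' - A) \<union> (A - A')))"
      using fin by (subst card_Un_disjoint) (auto simp: algebra_simps)
    finally show ?thesis
      by (simp add: avg_def \<rho>_def norm_divide divide_right_mono A_def A'_def)
  qed
  then show "\<forall>\<^sub>F N in sequentially. norm (avg \<Psi> N (\<lambda>n. u (Suc n) - u n)) \<le> C * \<rho> N" by simp
qed

lemma invariant_mean_Mset:
  assumes F: "foelner \<Psi>" and \<mu>: "\<mu> \<in> Mset \<Psi>"
  shows "invariant_mean (betaN_prob.mean \<mu>)"
proof -
  interpret betaN_prob \<mu> by (rule betaN_prob_Mset[OF \<mu>])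
  show ?thesis
  proof
    fix u v :: "nat \<Rightarrow> complex" and c :: complex and C :: real
    show "bounded (range u) \<Longrightarrow> bounded (range v) \<Longrightarrow> mean (\<lambda>n. u n + v n) = mean u + mean v"
      by (rule mean_add)
    show "bounded (range u) \<Longrightarrow> mean (\<lambda>n. c * u n) = c * mean u"
      by (rule mean_bounded_linear[OF bounded_linear_mult_right])
    show "(\<And>n. norm (u n) \<le> C) \<Longrightarrow> norm (mean u) \<le> C"
      by (rule norm_mean_le)
    assume u: "bounded (range u)"
    then obtain D where D: "\<And>n. norm (u n) \<le> D" by (auto simp: bounded_iff)
    have us: "bounded (range (\<lambda>n. u (Suc n)))" using D by (auto simp: bounded_iff)
    have "mean (\<lambda>n. (u (Suc n) - u n) + u n) = mean (\<lambda>n. u (Suc n) - u n) + mean u"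
      by (rule mean_add[OF bounded_minus_comp[OF us u] u])
    moreover have "mean (\<lambda>n. u (Suc n) - u n) = 0"
      by (rule mean_eq_limit[OF \<mu> bounded_minus_comp[OF us u] avg_shift_diff[OF F D]])
    ultimately show "mean (\<lambda>n. u (Suc n)) = mean u" by simp
  qed
qed

lemma Bes_perp_mean_cis:
  assumes \<mu>: "\<mu> \<in> Mset \<Psi>" and f: "f \<in> Bes_perp \<Psi>" "bounded (range f)"
  shows "betaN_prob.mean \<mu> (\<lambda>n. complex_of_real (f n) * cis (real n * \<theta>)) = 0"
proof (rule mean_eq_limit[OF \<mu>])
  obtain C where "\<And>n. \<bar>f n\<bar> \<le> C" using f(2) by (auto simp: bounded_iff)
  then show "bounded (range (\<lambda>n. complex_of_real (f n) * cis (real n * \<theta>)))"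
    by (auto simp: bounded_iff norm_mult)
  \<comment> \<open>\<open>Bes_perp\<close> speaks of frequencies in \<open>[0, 1)\<close>; as
    \<open>n\<close> is an integer, the fractional part gives the same exponential.\<close>
  define x where "x = frac (\<theta> / (2 * pi))"
  have "exp (2 * pi * \<i> * of_nat n * of_real x) = cis (real n * \<theta>)" for n
    using cis_mult_frac[of n "\<theta> / (2 * pi)"] by (simp add: cis_conv_exp x_def mult_ac)
  moreover have "0 \<le> x" "x < 1" by (auto simp: x_def frac_lt_1)
  ultimately show "(\<lambda>N. avg \<Psi> N (\<lambda>n. complex_of_real (f n) * cis (real n * \<theta>))) \<longlonglongrightarrow> 0"
    using f(1) unfolding Bes_perp_def by (auto dest!: spec[of _ x])
qed

section \<open>Positivity of the measure\<close>

lemma mean_shift_times_almost_periodic: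
  fixes f b :: "nat \<Rightarrow> real"
  assumes F: "foelner \<Psi>" and \<mu>: "\<mu> \<in> Mset \<Psi>"
    and f: "f \<in> Bes_perp \<Psi>" "bounded (range f)" and b: "bounded (range b)"
    and per: "\<And>\<theta> e. e > 0 \<Longrightarrow> \<exists>Q>0. \<forall>m. \<exists>k\<in>{m..<m + Q}.
               (\<forall>n. norm (b (n + k) - b n) \<le> e) \<and> norm (cis (real k * \<theta>) - 1) \<le> e"
  shows "betaN_prob.mean \<mu> (\<lambda>n. f (m + n) * b n) = 0"
proof -
  interpret betaN_prob \<mu> by (rule betaN_prob_Mset[OF \<mu>])
  interpret invariant_mean mean by (rule invariant_mean_Mset[OF F \<mu>])
  obtain C where C: "\<And>n. \<bar>f n\<bar> \<le> C" using f(2) by (auto simp: bounded_iff)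
  obtain D where D: "\<And>n. \<bar>b n\<bar> \<le> D" using b by (auto simp: bounded_iff)
  \<comment> \<open>Shift invariance moves the translation from \<open>f\<close> to the exponential,
    where it becomes a constant phase.\<close>
  have orth: "mean (\<lambda>n. complex_of_real (f (m + n)) * cis (real n * \<theta>)) = 0" for \<theta>
  proof -
    define v where "v n = complex_of_real (f n) * cis (real n * \<theta>)" for n
    have v: "bounded (range v)" using C by (auto simp: bounded_iff v_def norm_mult)
    then have v': "bounded (range (\<lambda>n. v (n + m)))" by (auto simp: bounded_iff)
    have "complex_of_real (f (m + n)) * cis (real n * \<theta>) = cis (- (real m * \<theta>)) * v (n + m)" for n
    proof -
      have "cis (real n * \<theta>) = cis (- (real m * \<theta>)) * cis (real (n + m) * \<theta>)"
        by (simp add: cis_mult algebra_simps)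
      then show ?thesis by (simp add: v_def add.commute)
    qed
    then have "mean (\<lambda>n. complex_of_real (f (m + n)) * cis (real n * \<theta>))
        = cis (- (real m * \<theta>)) * mean v"
      by (simp add: scale[OF v'] shift_by[OF v])
    then show ?thesis using Bes_perp_mean_cis[OF \<mu> f] by (simp add: v_def[abs_def])
  qed
  have "mean (\<lambda>n. complex_of_real (f (m + n)) * complex_of_real (b n)) = 0"
  proof (rule orthogonal_almost_periodic[OF _ _ orth])
    show "norm (complex_of_real (f (m + n))) \<le> C" "norm (complex_of_real (b n)) \<le> D" for n
      using C D by simp_all
    show "\<exists>Q>0. \<forall>m. \<exists>k\<in>{m..<m + Q}.
        (\<forall>n. norm (complex_of_real (b (n + k)) - complex_of_real (b n)) \<le> e) \<and> norm (cis (real k * \<theta>) - 1) \<le> e"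
      if "e > 0" for \<theta> e
      using per[OF that] by (simp flip: of_real_diff)
  qed
  moreover have "bounded (range (\<lambda>n. f (m + n) * b n))"
    unfolding bounded_iff using C D
    by (auto simp: abs_mult intro!: exI[of _ "C * D"] mult_mono order_trans[OF abs_ge_zero C])
  then have "mean (\<lambda>n. complex_of_real (f (m + n) * b n)) = complex_of_real (mean (\<lambda>n. f (m + n) * b n))"
    by (rule mean_bounded_linear[OF bounded_linear_of_real])
  ultimately show ?thesis by simp
qed

text \<open>A sum of \<open>Q\<close> consecutive shifts of \<open>b\<close> is at least
  \<open>\<eta>\<close> everywhere, and by shift invariance its mean is \<open>Q\<close> times that
  of \<open>b\<close>.\<close>

lemma mean_almost_periodic_pos:
  fixes b :: "nat \<Rightarrow> real"
  assumes F: "foelner \<Psi>" and \<mu>: "\<mu> \<in> Mset \<Psi>"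
    and b: "bounded (range b)" "\<And>n. b n \<ge> 0" "b n0 > 0"
    and per: "syndetic_periods b"
  shows "betaN_prob.mean \<mu> b > 0"
proof -
  interpret betaN_prob \<mu> by (rule betaN_prob_Mset[OF \<mu>])
  interpret invariant_mean mean by (rule invariant_mean_Mset[OF F \<mu>])
  define \<eta> where "\<eta> = b n0 / 2"
  have \<eta>: "\<eta> > 0" using b by (simp add: \<eta>_def)
  obtain Q where Q: "Q > 0" "\<And>m. \<exists>k\<in>{m..<m + Q}. \<forall>n. norm (b (n + k) - b n) \<le> \<eta>"
    using per \<eta> unfolding syndetic_periods_def by blast
  \<comment> \<open>An almost period \<open>k\<close> in \<open>{m..<m + Q}\<close> recovers at
    least half of \<open>b n0\<close>; it gives the summand with \<open>j = k - m\<close>.\<close>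
  have low: "\<eta> \<le> (\<Sum>j<Q. b (m + (n0 + j)))" for m
  proof -
    obtain k where k: "k \<in> {m..<m + Q}" "\<bar>b (n0 + k) - b n0\<bar> \<le> \<eta>" using Q by fastforce
    then have "b (n0 + k) \<ge> \<eta>" unfolding \<eta>_def by linarith
    also have "b (n0 + k) = b (m + (n0 + (k - m)))" using k by (auto intro!: arg_cong[of _ _ b])
    also have "\<dots> \<le> (\<Sum>j<Q. b (m + (n0 + j)))"
      by (rule member_le_sum) (use k b in auto)
    finally show ?thesis .
  qed
  have bc: "bounded (range (\<lambda>n. complex_of_real (b n)))"
    using b(1) by (auto simp: bounded_iff)
  have bs: "bounded (range (\<lambda>n. complex_of_real (b (n + (n0 + j)))))" for j
    using bc by (auto simp: bounded_iff)
  define u where "u n = (\<Sum>j<Q. b (n + (n0 + j)))" for n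
  have "bounded (range (\<lambda>n. \<Sum>j<Q. complex_of_real (b (n + (n0 + j)))))"
    by (rule sum[THEN conjunct2]) (use bs in auto)
  then have u: "bounded (range u)"
    by (auto simp: bounded_iff u_def norm_of_real simp flip: of_real_sum)
  have "complex_of_real (mean u) = mean (\<lambda>n. \<Sum>j<Q. complex_of_real (b (n + (n0 + j))))"
    using mean_bounded_linear[OF bounded_linear_of_real[where ?'a = complex] u] by (simp add: u_def)
  also have "\<dots> = (\<Sum>j<Q. mean (\<lambda>n. complex_of_real (b (n + (n0 + j)))))"
    by (rule sum[THEN conjunct1]) (use bs in auto)
  also have "\<dots> = of_nat Q * mean (\<lambda>n. complex_of_real (b n))"
    using shift_by[OF bc] by simp
  also have "\<dots> = complex_of_real (real Q * mean b)"
    using mean_bounded_linear[OF bounded_linear_of_real[where ?'a = complex] b(1)] by simp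
  finally have "mean u = real Q * mean b" by (simp only: of_real_eq_iff)
  moreover have "mean u \<ge> \<eta>" by (rule mean_ge[OF u]) (simp add: u_def low)
  ultimately have "real Q * mean b > 0" using \<eta> by simp
  then show ?thesis using Q by (simp add: zero_less_mult_iff)
qed

text \<open>Fatou's lemma for \<open>w (K - \<phi>\<^sub>N) \<ge> 0\<close>.\<close>
lemma (in prob_space) AE_limsup_nonneg:
  fixes w :: "'a \<Rightarrow> real" and \<phi> :: "nat \<Rightarrow> 'a \<Rightarrow> real"
  assumes [measurable]: "w \<in> borel_measurable M" "\<And>N. \<phi> N \<in> borel_measurable M"
    and w: "\<And>x. x \<in> space M \<Longrightarrow> w x \<ge> 0" "integrable M w" "(\<integral>x. w x \<partial>M) > 0"
    and K: "\<And>N x. x \<in> space M \<Longrightarrow> \<bar>\<phi> N x\<bar> \<le> K"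
    and zero: "\<And>N. (\<integral>x. w x * \<phi> N x \<partial>M) = 0"
  shows "\<not> (AE x in M. w x > 0 \<longrightarrow> limsup (\<lambda>N. ereal (\<phi> N x)) < 0)"
proof
  assume neg: "AE x in M. w x > 0 \<longrightarrow> limsup (\<lambda>N. ereal (\<phi> N x)) < 0"
  have K0: "K \<ge> 0"
  proof -
    obtain x where "x \<in> space M" using not_empty by blast
    then show ?thesis using K[of x 0] by linarith
  qed
  have int_w\<phi>: "integrable M (\<lambda>x. w x * \<phi> N x)" for N
  proof (rule Bochner_Integration.integrable_bound[of M "\<lambda>x. K * w x"])
    show "AE x in M. norm (w x * \<phi> N x) \<le> norm (K * w x)"
      using K K0 w(1) by (intro AE_I2) (simp add: abs_mult mult.commute[of K] mult_left_mono)
  qed (use w(2) in auto)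
  define u where "u N x = ennreal (w x * (K - \<phi> N x))" for N x
  define g where "g x = ennreal (w x * K)" for x
  have [measurable]: "u N \<in> borel_measurable M" "g \<in> borel_measurable M" for N
    unfolding u_def g_def by measurable
  \<comment> \<open>By \<open>zero\<close> the term with \<open>\<phi> N\<close> integrates to
    nothing, so every \<open>u N\<close> has the same integral as \<open>g\<close>.\<close>
  have int_u: "(\<integral>\<^sup>+x. u N x \<partial>M) = ennreal (K * (\<integral>x. w x \<partial>M))" for N
  proof -
    have "(\<integral>\<^sup>+x. u N x \<partial>M) = ennreal (\<integral>x. w x * (K - \<phi> N x) \<partial>M)"
      unfolding u_def
    proof (rule nn_integral_eq_integral)
      show "integrable M (\<lambda>x. w x * (K - \<phi> N x))"
        using w(2) int_w\<phi>[of N] by (simp add: right_diff_distrib)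
      show "AE x in M. 0 \<le> w x * (K - \<phi> N x)"
        using K w(1) by (intro AE_I2 mult_nonneg_nonneg) (auto simp: abs_le_iff)
    qed
    also have "(\<integral>x. w x * (K - \<phi> N x) \<partial>M) = K * (\<integral>x. w x \<partial>M)"
      using w(2) int_w\<phi>[of N] zero[of N] by (simp add: right_diff_distrib mult.commute)
    finally show ?thesis .
  qed
  have int_g: "(\<integral>\<^sup>+x. g x \<partial>M) = ennreal (K * (\<integral>x. w x \<partial>M))"
    unfolding g_def using w(1,2) K0
    by (subst nn_integral_eq_integral) (auto simp: mult.commute intro!: AE_I2)
  \<comment> \<open>The number \<open>d\<close> keeps a gap below \<open>0\<close> that survives the
    lower limit: eventually \<open>u N\<close> exceeds \<open>g\<close> by at least
    \<open>w x * (- d)\<close>.\<close>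
  have strict: "g x < liminf (\<lambda>N. u N x)"
    if x: "w x > 0" "limsup (\<lambda>N. ereal (\<phi> N x)) < 0" for x
  proof -
    obtain d :: real where d: "limsup (\<lambda>N. ereal (\<phi> N x)) < ereal d" "d < 0"
      using ereal_dense2[OF x(2)] by auto
    have "eventually (\<lambda>N. ereal (\<phi> N x) < ereal d) sequentially"
      by (rule Limsup_lessD[OF d(1)])
    then have "eventually (\<lambda>N. ennreal (w x * (K - d)) \<le> u N x) sequentially"
      by (rule eventually_mono) (use x in \<open>auto simp: u_def intro!: ennreal_leI mult_left_mono\<close>)
    then have "ennreal (w x * (K - d)) \<le> liminf (\<lambda>N. u N x)"
      by (rule Liminf_bounded)
    moreover have "g x < ennreal (w x * (K - d))"
      unfolding g_def using x d K0 by (intro ennreal_lessI mult_pos_pos mult_strict_left_mono) auto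
    ultimately show ?thesis by (rule less_le_trans[rotated])
  qed
  have "(\<integral>\<^sup>+x. g x \<partial>M) < (\<integral>\<^sup>+x. liminf (\<lambda>N. u N x) \<partial>M)"
  proof (rule nn_integral_less)
    show "(\<integral>\<^sup>+x. g x \<partial>M) \<noteq> \<infinity>" by (simp add: int_g)
    show "AE x in M. g x \<le> liminf (\<lambda>N. u N x)"
      using neg AE_space
    proof eventually_elim
      case (elim x)
      show ?case
      proof (cases "w x > 0")
        case True
        then show ?thesis using elim strict less_imp_le by blast
      next
        case False
        then have "w x = 0" using w(1) elim by fastforce
        then show ?thesis by (simp add: g_def)
      qed
    qed
    \<comment> \<open>The reverse inequality contradicts \<open>strict\<close> wherever
      \<open>w > 0\<close>, so it would make \<open>w\<close> vanish almost everywhere, against its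
      positive integral.\<close>
    show "\<not> (AE x in M. liminf (\<lambda>N. u N x) \<le> g x)"
    proof
      assume "AE x in M. liminf (\<lambda>N. u N x) \<le> g x"
      then have "AE x in M. w x = 0"
        using neg AE_space
      proof eventually_elim
        case (elim x)
        then have "\<not> w x > 0" using strict leD by blast
        then show ?case using w(1) elim by fastforce
      qed
      then have "(\<integral>x. w x \<partial>M) = 0" by (rule integral_eq_zero_AE)
      then show False using w(3) by simp
    qed
  qed simp_all
  also have "\<dots> \<le> liminf (\<lambda>N. \<integral>\<^sup>+x. u N x \<partial>M)"
    by (rule nn_integral_liminf) simp
  finally show False by (simp add: int_u int_g Liminf_const)
qed

theorem theorem4p11:
  fixes \<Psi> :: "nat \<Rightarrow> nat set" and f :: "nat \<Rightarrow> real"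
    and a :: "nat \<Rightarrow> 'k::{metric_space, ab_group_add, topological_group_add}" and U :: "'k set"
    and B :: "nat set" and h :: "nat \<Rightarrow> real"
  assumes "foelner \<Psi>"
    and "bounded (range f)" and "f \<in> Bes_perp \<Psi>"
    and "bohr_data a U" and "B = a -` U" and "B \<noteq> {}"
    and "bounded (range h)"
  defines "S \<equiv> {p \<in> clb B. limsup (\<lambda>N. ereal (avg \<Psi> N (\<lambda>m. h m * Rsh p f m))) \<ge> 0}"
  shows "S \<in> sets (borel_of betaN) \<and> (\<forall>\<mu>\<in>Mset \<Psi>. emeasure \<mu> S > 0)"
proof -
  define \<phi> where "\<phi> N p = avg \<Psi> N (\<lambda>m. h m * Rsh p f m)" for N p
  have f_shift: "bounded (range (\<lambda>n. f (m + n)))" for m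
    using assms(2) by (auto simp: bounded_iff)
  have [measurable]: "(\<lambda>p. Rsh p f m) \<in> borel_measurable (borel_of betaN)" for m
    unfolding Rsh_def by (intro continuous_map_borel_measurable continuous_map_Lim f_shift)
  have \<phi>_meas [measurable]: "\<phi> N \<in> borel_measurable (borel_of betaN)" for N
    unfolding \<phi>_def avg_def by measurable
  have "S = clb B \<inter> {p \<in> space (borel_of betaN). 0 \<le> limsup (\<lambda>N. ereal (\<phi> N p))}"
    by (auto simp: S_def \<phi>_def space_borel_of topspace_betaN clb_def)
  moreover have "{p \<in> space (borel_of betaN). 0 \<le> limsup (\<lambda>N. ereal (\<phi> N p))} \<in> sets (borel_of betaN)"
    by measurable
  ultimately have S: "S \<in> sets (borel_of betaN)"
    using openin_imp_borel_of[OF openin_clb] by auto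
  obtain n0 where n0: "a n0 \<in> U" using assms(5,6) by auto
  from assms(4) have "open U" and K: "compact (UNIV :: 'k set)"
    and hom: "\<And>m n. a (m + n) = a m + a n" by (auto simp: bohr_data_def)
  then obtain r where r: "r > 0" "ball (a n0) r \<subseteq> U" using n0 open_contains_ball by blast
  \<comment> \<open>This bump is positive exactly on \<open>ball (a n0) r\<close>, so
    \<open>b\<close> is positive at \<open>n0\<close> and vanishes off \<open>B\<close>; its
    continuity makes \<open>b\<close> almost periodic.\<close>
  define g where "g x = max 0 (r - dist (a n0) x)" for x
  have g: "continuous_on UNIV g" unfolding g_def by (intro continuous_intros)
  define b where "b n = g (a n)" for n
  have b0: "b n \<ge> 0" for n by (simp add: b_def g_def)
  have bB: "b n = 0" if "n \<notin> B" for n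
    using that r assms(5) by (force simp: b_def g_def max_def subset_iff not_le)
  have bb: "bounded (range b)"
    unfolding bounded_iff using r by (auto simp: b_def g_def intro!: exI[of _ r])
  have per: "\<exists>Q>0. \<forall>m. \<exists>k\<in>{m..<m + Q}.
      (\<forall>n. norm (b (n + k) - b n) \<le> e) \<and> norm (cis (real k * \<theta>) - 1) \<le> e" if "e > 0" for \<theta> e
    unfolding b_def by (rule bohr_periods[OF K hom g that])
  have "syndetic_periods b"
    unfolding syndetic_periods_def using per by meson
  have "emeasure \<mu> S > 0" if \<mu>: "\<mu> \<in> Mset \<Psi>" for \<mu>
  proof (rule ccontr)
    interpret betaN_prob \<mu> by (rule betaN_prob_Mset[OF \<mu>])
    assume "\<not> emeasure \<mu> S > 0"
    then have null: "S \<in> null_sets \<mu>" using S by (auto simp: null_sets_def sets_mu)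
    define w where "w p = Lim p b" for p
    obtain C where C: "\<And>n. norm (f n) \<le> C" using assms(2) by (auto simp: bounded_iff)
    obtain D where D: "\<And>n. norm (h n) \<le> D" using assms(7) by (auto simp: bounded_iff)
    have Rsh_le: "norm (Rsh p f m) \<le> C" if "p \<in> space \<mu>" for p m
      unfolding Rsh_def using that C by (intro norm_Lim_le) (auto simp: space_mu)
    \<comment> \<open>If \<open>p\<close> does not contain \<open>B\<close>, it contains the
      complement, where \<open>b\<close> vanishes; so \<open>w\<close> is supported in
      \<open>clb B\<close>.\<close>
    have w_pos: "p \<in> clb B" if p: "p \<in> space \<mu>" and "w p > 0" for p
    proof (rule ccontr)
      assume "p \<notin> clb B"
      then have "eventually (\<lambda>n. n \<notin> B) p"
        using p by (auto simp: clb_def space_mu ultrafilter_def)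
      then have "(b \<longlongrightarrow> 0) p"
        by (intro tendsto_eventually) (auto elim!: eventually_mono intro: bB)
      then have "w p = 0"
        unfolding w_def using p by (intro Lim_ultrafilter_eqI) (auto simp: space_mu)
      with \<open>w p > 0\<close> show False by simp
    qed
    have w0: "w p \<ge> 0" if "p \<in> space \<mu>" for p
      using tendsto_lowerbound[OF tendsto_Lim_ultrafilter[OF _ bb], of p 0] that b0
      by (auto simp: w_def space_mu ultrafilter_def)
    \<comment> \<open>Limits along an ultrafilter are multiplicative, so the integral of
      \<open>w p * Rsh p f m\<close> becomes the mean of a product of sequences, to which
      orthogonality applies.\<close>
    have prod: "w p * Rsh p f m = Lim p (\<lambda>n. f (m + n) * b n)" if "p \<in> space \<mu>" for p m
      unfolding w_def Rsh_def using that
      by (subst mult.commute, intro Lim_ultrafilter_eqI[symmetric] tendsto_mult tendsto_Lim_ultrafilter f_shift bb)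
         (auto simp: space_mu)
    have fb: "bounded (range (\<lambda>n. f (m + n) * b n))" for m
    proof -
      obtain E where "\<And>n. norm (b n) \<le> E" using bb by (auto simp: bounded_iff)
      then show ?thesis
        unfolding bounded_iff using C order_trans[OF norm_ge_zero C]
        by (auto simp: abs_mult intro!: exI[of _ "C * E"] mult_mono)
    qed
    have int: "integrable \<mu> (\<lambda>p. w p * Rsh p f m)" for m
      by (rule Bochner_Integration.integrable_cong[THEN iffD2, OF refl prod Lim_integrable[OF fb]])
    have int0: "(\<integral>p. w p * Rsh p f m \<partial>\<mu>) = 0" for m
    proof -
      have "(\<integral>p. w p * Rsh p f m \<partial>\<mu>) = mean (\<lambda>n. f (m + n) * b n)"
        unfolding mean_def by (rule Bochner_Integration.integral_cong) (auto simp: prod)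
      also have "\<dots> = 0"
        by (rule mean_shift_times_almost_periodic[OF assms(1) \<mu> assms(3,2) bb per])
      finally show ?thesis .
    qed
    have "\<not> (AE p in \<mu>. w p > 0 \<longrightarrow> limsup (\<lambda>N. ereal (\<phi> N p)) < 0)"
    proof (rule AE_limsup_nonneg)
      show "w \<in> borel_measurable \<mu>" unfolding w_def by (rule Lim_measurable[OF bb])
      show "\<phi> N \<in> borel_measurable \<mu>" for N
        using \<phi>_meas measurable_cong_sets[OF sets_mu refl] by blast
      show "w p \<ge> 0" if "p \<in> space \<mu>" for p by (rule w0[OF that])
      show "integrable \<mu> w" unfolding w_def by (rule Lim_integrable[OF bb])
      show "(\<integral>p. w p \<partial>\<mu>) > 0"
        using mean_almost_periodic_pos[OF assms(1) \<mu> bb b0 _ \<open>syndetic_periods b\<close>, of n0] r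
        by (simp add: mean_def w_def b_def g_def)
      show "\<bar>\<phi> N p\<bar> \<le> D * C" if "p \<in> space \<mu>" for N p
      proof -
        have "norm (h m * Rsh p f m) \<le> D * C" for m
          unfolding norm_mult using D Rsh_le[OF that] order_trans[OF norm_ge_zero D]
          by (intro mult_mono) auto
        then show ?thesis
          using norm_avg_le[OF assms(1), of "\<lambda>m. h m * Rsh p f m" "D * C" N] by (simp add: \<phi>_def)
      qed
      show "(\<integral>p. w p * \<phi> N p \<partial>\<mu>) = 0" for N
      proof -
        have "(\<lambda>p. w p * \<phi> N p)
            = (\<lambda>p. (\<Sum>m\<in>\<Psi> N. h m * (w p * Rsh p f m)) / real (card (\<Psi> N)))"
          by (simp add: \<phi>_def avg_def sum_distrib_left mult.left_commute)
        then show ?thesis using int int0 by simp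
      qed
    qed
    \<comment> \<open>A point outside the null set \<open>S\<close> with \<open>w p > 0\<close> lies
      in \<open>clb B\<close>, so it must fail the condition on the limsup.\<close>
    moreover have "AE p in \<mu>. w p > 0 \<longrightarrow> limsup (\<lambda>N. ereal (\<phi> N p)) < 0"
      using AE_not_in[OF null] AE_space
      by eventually_elim (use w_pos in \<open>auto simp: S_def \<phi>_def not_le\<close>)
    ultimately show False by blast
  qed
  then show ?thesis using S by blast
qed

end
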